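(* Let $d\ge1$ and let $E\subset[1,2]$ be nonempty with upper Minkowski dimension $\dim_M(E)=\beta$. Let $m$ be an $a$-admissible bilinear multiplier up to order $1$ on $\mathbb{R}^{2d}$, and assume $2a>d+\beta$. Then there exists $\gamma>0$ such that $$\|\mathcal{A}_{m,E}(f-\tau_hf,g)\|_{L^2}+\|\mathcal{A}_{m,E}(f,g-\tau_hg)\|_{L^2}\lesssim|h|^\gamma\|f\|_{L^2}\|g\|_{L^2},\quad\forall\,|h|<1.$$ Moreover, under the same hypothesis there exist $\gamma_1,\gamma_2>0$ such that $$\|\mathcal{A}_{m,E}(f-\tau_{h_1}f,g-\tau_{h_2}g)\|_{L^2}\lesssim|h_1|^{\gamma_1}|h_2|^{\gamma_2}\|f\|_{L^2}\|g\|_{L^2},\quad\forall\,|h_1|<1,\ |h_2|<1.$$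
   Context: All functions are on $\mathbb{R}^d$, $h,h_1,h_2\in\mathbb{R}^d$, and $\tau_hf(x)=f(x-h)$. Operators are initially defined for $f,g\in C_0^\infty(\mathbb{R}^d)$, and $A\lesssim B$ means $A\le CB$ with $C$ independent of $f,g,h,h_1,h_2$. The Fourier transform is $\hat f(\xi)=\int f(x)e^{-2\pi i x\cdot\xi}\,dx$. Admissible multipliers: for $k\ge 0$, a bounded function $m:\mathbb{R}^{2d}\to\mathbb{C}$ is $a$-admissible up to order $k$ if $m\in C^k(\mathbb{R}^{2d})$, $a>\frac d2$, and $|\partial^\alpha m(\xi,\eta)|\lesssim_\alpha (1+|\xi|+|\eta|)^{-a}$ for all multi-indices $\alpha$ with $|\alpha|\le k$ and all $\xi,\eta\in\mathbb{R}^d$. For $t>0$, $m_t(\xi,\eta)=m(t\xi,t\eta)$, and $$T_{m}(f,g)(x)=\int_{\mathbb{R}^{2d}}\hat f(\xi)\hat g(\eta)m(\xi,\eta)e^{2\pi i x\cdot(\xi+\eta)}\,d\xi d\eta,\qquad \mathcal{A}_{m,E}(f,g)(x)=\sup_{t\in E}|T_{m_t}(f,g)(x)|.$$ Upper Minkowski dimension: $\dim_M(E)=\limsup_{\delta\to0}\frac{\log N(E,\delta)}{\log(1/\delta)}$, where $N(E,\delta)$ is the minimal number of closed intervals of length $\delta$ needed to cover $E$. *)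

theory Defs
  imports "HOL-Analysis.Analysis"
begin

definition partial_deriv ::
  "'a::real_normed_vector \<Rightarrow> ('a \<Rightarrow> 'b::real_normed_vector) \<Rightarrow> 'a \<Rightarrow> 'b" where
  "partial_deriv b f x = vector_derivative (\<lambda>t. f (x + t *\<^sub>R b)) (at 0)"

text \<open>
  A multi-index \<open>\<alpha>\<close> is encoded by a list of coordinate vectors, each listed as often as \<open>\<alpha>\<close>
  prescribes; \<open>\<bar>\<alpha>\<bar>\<close> is the length of the list.  All orderings are admitted below, which is
  harmless because mixed partial derivatives up to order \<open>k\<close> of a \<open>C\<^sup>k\<close> function commute.
\<close>

definition multi_indices :: "nat \<Rightarrow> 'a::euclidean_space list set" where
  "multi_indices k = {bs. set bs \<subseteq> Basis \<and> length bs \<le> k}"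

primrec iter_deriv ::
  "'a::real_normed_vector list \<Rightarrow> ('a \<Rightarrow> 'b::real_normed_vector) \<Rightarrow> 'a \<Rightarrow> 'b" where
  "iter_deriv [] f = f"
| "iter_deriv (b # bs) f = partial_deriv b (iter_deriv bs f)"

text \<open>
  The existence of the partial derivatives has to be required separately, since
  \<^const>\<open>vector_derivative\<close> also has an (unspecified) value where no derivative exists.
\<close>

definition C_diff :: "nat \<Rightarrow> ('a::euclidean_space \<Rightarrow> 'b::real_normed_vector) \<Rightarrow> bool" where
  "C_diff k f \<longleftrightarrow>
     (\<forall>b bs x. b # bs \<in> multi_indices k \<longrightarrow>
        (\<lambda>t::real. iter_deriv bs f (x + t *\<^sub>R b)) differentiable (at 0)) \<and>
     (\<forall>bs \<in> multi_indices k. continuous_on UNIV (iter_deriv bs f))"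

definition test_function :: "('a::euclidean_space \<Rightarrow> complex) \<Rightarrow> bool" where
  "test_function f \<longleftrightarrow> (\<forall>k. C_diff k f) \<and> compact (closure {x. f x \<noteq> 0})"

definition translate :: "'a::real_normed_vector \<Rightarrow> ('a \<Rightarrow> complex) \<Rightarrow> 'a \<Rightarrow> complex" where
  "translate h f x = f (x - h)"

definition fourier :: "('a::euclidean_space \<Rightarrow> complex) \<Rightarrow> 'a \<Rightarrow> complex" where
  "fourier f \<xi> = (LINT x|lborel. f x * cis (- 2 * pi * (x \<bullet> \<xi>)))"

definition admissible ::
  "nat \<Rightarrow> real \<Rightarrow> ('a::euclidean_space \<times> 'a \<Rightarrow> complex) \<Rightarrow> bool" where
  "admissible k a m \<longleftrightarrow>
     bounded (range m) \<and> C_diff k m \<and> a > real DIM('a) / 2 \<and>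
     (\<forall>\<alpha> \<in> multi_indices k. \<exists>C. \<forall>\<xi> \<eta>.
        norm (iter_deriv \<alpha> m (\<xi>, \<eta>)) \<le> C * (1 + norm \<xi> + norm \<eta>) powr (- a))"

definition dilate ::
  "real \<Rightarrow> ('a::real_vector \<times> 'a \<Rightarrow> complex) \<Rightarrow> 'a \<times> 'a \<Rightarrow> complex" where
  "dilate t m = (\<lambda>(\<xi>, \<eta>). m (t *\<^sub>R \<xi>, t *\<^sub>R \<eta>))"

definition bilinear_op ::
  "('a::euclidean_space \<times> 'a \<Rightarrow> complex) \<Rightarrow> ('a \<Rightarrow> complex) \<Rightarrow> ('a \<Rightarrow> complex) \<Rightarrow> 'a \<Rightarrow> complex"
  where
  "bilinear_op m f g x =
     (LINT (\<xi>, \<eta>)|lborel.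
        fourier f \<xi> * fourier g \<eta> * m (\<xi>, \<eta>) * cis (2 * pi * (x \<bullet> (\<xi> + \<eta>))))"

definition maximal_op ::
  "('a::euclidean_space \<times> 'a \<Rightarrow> complex) \<Rightarrow> real set \<Rightarrow>
   ('a \<Rightarrow> complex) \<Rightarrow> ('a \<Rightarrow> complex) \<Rightarrow> 'a \<Rightarrow> ennreal" where
  "maximal_op m E f g x = (SUP t\<in>E. ennreal (norm (bilinear_op (dilate t m) f g x)))"

text \<open>
  Extended-valued, so that an infinite supremum or a divergent integral is not silently
  assigned a finite norm.
\<close>

definition L2_norm :: "('a::euclidean_space \<Rightarrow> ennreal) \<Rightarrow> ennreal" where
  "L2_norm F =
     (let I = (\<integral>\<^sup>+ x. (F x)\<^sup>2 \<partial>lborel) in if I = \<infinity> then \<infinity> else ennreal (sqrt (enn2real I)))"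

definition covering_number :: "real set \<Rightarrow> real \<Rightarrow> nat" where
  "covering_number E \<delta> =
     (LEAST n. \<exists>S. finite S \<and> card S = n \<and> E \<subseteq> (\<Union>c\<in>S. {c..c + \<delta>}))"

definition upper_minkowski_dim :: "real set \<Rightarrow> ereal" where
  "upper_minkowski_dim E =
     Limsup (at_right 0) (\<lambda>\<delta>. ereal (ln (real (covering_number E \<delta>)) / ln (1 / \<delta>)))"

end

theory Submission
  imports Defs "HOL-Probability.Characteristic_Functions"
begin

text \<open>
  Cauchy--Schwarz in \<open>\<eta>\<close> and Plancherel show that a bilinear multiplier bounded by \<open>b\<close> and supported
  in a ball of radius \<open>r\<close> maps \<open>L\<^sup>2 \<times> L\<^sup>2\<close> to \<open>L\<^sup>2\<close> with norm \<open>O(b r\<^bsup>d/2\<^esup>)\<close>.  The multiplier is cut sharply into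
  dyadic shells of \<open>1 + \<bar>\<xi>\<bar> + \<bar>\<eta>\<bar> \<approx> 2\<^bsup>j\<^esup>\<close>, independently of the dilation \<open>t\<close>.  On the \<open>j\<close>-th shell \<open>m\<^sub>t\<close> is of
  size \<open>2\<^bsup>-ja\<^esup>\<close> and Lipschitz in \<open>t\<close> with constant \<open>2\<^bsup>j(1-a)\<^esup>\<close>, so the supremum over \<open>t \<in> E\<close> is controlled by
  chaining through the dyadic numbers of scale \<open>2\<^bsup>-k\<^esup>\<close>, \<open>k \<ge> j\<close>, near \<open>E\<close>, of which there are \<open>O(2\<^bsup>ks\<^esup>)\<close> for a suitable
  \<open>s \<le> 1\<close> with \<open>d + s < 2a\<close>.  The shell contributes \<open>O(2\<^bsup>-j(2a-d-s)/2\<^esup>)\<close>, which is summable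
  with room to spare.  A difference \<open>f - \<tau>\<^sub>h f\<close> multiplies the symbol by \<open>1 - e\<^bsup>-2\<pi>ih\<cdot>\<xi>\<^esup> = O(\<bar>h\<bar>\<^sup>\<gamma> \<bar>\<xi>\<bar>\<^sup>\<gamma>)\<close>, and
  the room absorbs the growth in \<open>\<xi>\<close> for small \<open>\<gamma>\<close>.
\<close>

section \<open>Plancherel's inequality\<close>

lemma cis_measurable [measurable]: "cis \<in> borel_measurable borel"
  unfolding cis_conv_exp by measurable

lemma cnj_measurable [measurable]: "cnj \<in> borel_measurable borel"
  by (intro borel_measurable_continuous_onI continuous_intros)

text \<open>A divergent Bochner integral has the value 0, which settles the non-integrable
  case.\<close>

lemma norm_integral_le_nn_integral:
  fixes f :: "'a \<Rightarrow> complex"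
  shows "ennreal (norm (integral\<^sup>L M f)) \<le> (\<integral>\<^sup>+ x. ennreal (norm (f x)) \<partial>M)"
  by (cases "integrable M f") (auto simp: integral_norm_bound_ennreal not_integrable_integral_eq)

section \<open>Gaussians and their Fourier transforms\<close>

lemma integrable_gaussian:
  fixes n :: real
  assumes "n > 0"
  shows "integrable lborel (\<lambda>s. exp (- (s / n)\<^sup>2 / 2))"
proof -
  have "exp (- (s / n)\<^sup>2 / 2) = sqrt (2 * pi * n\<^sup>2) * normal_density 0 n s" for s
    using assms by (simp add: normal_density_def power_divide)
  moreover have "integrable lborel (\<lambda>s. sqrt (2 * pi * n\<^sup>2) * normal_density 0 n s)"
    using assms by (intro integrable_mult_right integrable_normal_density)
  ultimately show ?thesis by simp
qed

lemma integral_gaussian_cis: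
  assumes n: "n > 0"
  shows "(LINT s|lborel. complex_of_real (exp (- (s / n)\<^sup>2 / 2)) * cis (- 2 * pi * (s * y)))
    = complex_of_real (normal_density 0 (1 / (2 * pi * n)) y)"
proof -
  \<comment> \<open>The substitution \<open>s = n * x\<close> turns the frequency \<open>y\<close>
    into \<open>?t\<close>, at which the characteristic function of the standard normal law is
    evaluated.\<close>
  let ?t = "- 2 * pi * n * y"
  have "complex_of_real (exp (- ?t\<^sup>2 / 2)) = (LINT x|lborel. std_normal_density x *\<^sub>R iexp (?t * x))"
    unfolding char_std_normal_distribution[THEN fun_cong, of ?t, symmetric] char_def
    by (subst integral_density) auto
  also have "\<dots> = (LINT x|lborel. (1 / sqrt (2 * pi)) *\<^sub>R (exp (- x\<^sup>2 / 2) *\<^sub>R iexp (?t * x)))"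
    by (simp add: std_normal_density_def)
  also have "\<dots> = (1 / sqrt (2 * pi)) *\<^sub>R (LINT x|lborel. exp (- x\<^sup>2 / 2) *\<^sub>R iexp (?t * x))"
    by (rule integral_scaleR_right)
  finally have 1: "(LINT x|lborel. exp (- x\<^sup>2 / 2) *\<^sub>R iexp (?t * x))
      = complex_of_real (sqrt (2 * pi) * exp (- ?t\<^sup>2 / 2))"
    by (simp add: scaleR_conv_of_real field_simps)
  have "(LINT s|lborel. complex_of_real (exp (- (s / n)\<^sup>2 / 2)) * cis (- 2 * pi * (s * y)))
     = \<bar>n\<bar> *\<^sub>R (LINT x|lborel. complex_of_real (exp (- ((0 + n * x) / n)\<^sup>2 / 2)) * cis (- 2 * pi * ((0 + n * x) * y)))"
    using n by (intro lborel_integral_real_affine) simp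
  also have "(\<lambda>x. complex_of_real (exp (- ((0 + n * x) / n)\<^sup>2 / 2)) * cis (- 2 * pi * ((0 + n * x) * y)))
     = (\<lambda>x. exp (- x\<^sup>2 / 2) *\<^sub>R iexp (?t * x))"
    using n by (auto simp: fun_eq_iff scaleR_conv_of_real cis_conv_exp exp_of_real mult_ac)
  also note 1
  also have "\<bar>n\<bar> *\<^sub>R complex_of_real (sqrt (2 * pi) * exp (- ?t\<^sup>2 / 2))
      = complex_of_real (n * sqrt (2 * pi) * exp (- ?t\<^sup>2 / 2))"
    using n by (simp add: scaleR_conv_of_real)
  also have "n * sqrt (2 * pi) * exp (- ?t\<^sup>2 / 2) = normal_density 0 (1 / (2 * pi * n)) y"
  proof -
    have "2 * pi * (1 / (2 * pi * n))\<^sup>2 = 1 / (2 * pi * n\<^sup>2)"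
      using n by (simp add: field_simps power2_eq_square)
    moreover have "1 / sqrt (1 / (2 * pi * n\<^sup>2)) = n * sqrt (2 * pi)"
      using n by (simp add: real_sqrt_divide real_sqrt_mult)
    moreover have "- ?t\<^sup>2 / 2 = - (y - 0)\<^sup>2 / (2 * (1 / (2 * pi * n))\<^sup>2)"
      using n by (simp add: field_simps power2_eq_square)
    ultimately show ?thesis
      unfolding normal_density_def by simp
  qed
  finally show ?thesis .
qed

text \<open>A product over coordinates rather than the exponential of a squared norm, so that
  integrals over the space factor into one-dimensional ones.\<close>

definition gauss :: "real \<Rightarrow> 'a::euclidean_space \<Rightarrow> real" where
  "gauss n x = (\<Prod>b\<in>Basis. exp (- (x \<bullet> b / n)\<^sup>2 / 2))"

text \<open>For \<open>n > 0\<close> this is the transform of \<open>gauss n\<close>: a probability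
  density that concentrates at 0 as \<open>n\<close> grows.\<close>

definition gauss_hat :: "real \<Rightarrow> 'a::euclidean_space \<Rightarrow> real" where
  "gauss_hat n z = (\<Prod>b\<in>Basis. normal_density 0 (1 / (2 * pi * n)) (z \<bullet> b))"

lemma gauss_measurable [measurable]: "gauss n \<in> borel_measurable borel"
  unfolding gauss_def by measurable

lemma gauss_hat_measurable [measurable]: "gauss_hat n \<in> borel_measurable borel"
  unfolding gauss_hat_def by measurable

lemma gauss_nonneg: "0 \<le> gauss n x" and gauss_hat_nonneg: "0 \<le> gauss_hat n x"
  by (auto simp: gauss_def gauss_hat_def intro!: prod_nonneg)

lemma nn_integral_gauss_hat:
  assumes "n > 0"
  shows "(\<integral>\<^sup>+ z. ennreal (gauss_hat n z) \<partial>(lborel :: 'a::euclidean_space measure)) = 1"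
proof -
  have "(\<integral>\<^sup>+ z. ennreal (gauss_hat n z) \<partial>(lborel :: 'a measure)) = 
      (\<Prod>b\<in>(Basis :: 'a set). (\<integral>\<^sup>+x. ennreal (normal_density 0 (1 / (2 * pi * n)) x) \<partial>lborel))"
    unfolding gauss_hat_def
    by (subst nn_integral_lborel_prod[symmetric]) (auto simp: prod_ennreal)
  also have "(\<integral>\<^sup>+x. ennreal (normal_density 0 (1 / (2 * pi * n)) x) \<partial>lborel) = 1"
    using assms by (subst nn_integral_eq_integral)
      (auto simp: integral_normal_density integrable_normal_density)
  finally show ?thesis by simp
qed

lemma cis_sum: "finite A \<Longrightarrow> cis (\<Sum>a\<in>A. f a) = (\<Prod>a\<in>A. cis (f a))"
  by (induction A rule: finite_induct) (auto simp: cis_mult[symmetric])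

text \<open>Lebesgue measure is the image of a product measure under the coordinate map, and both
  the Gaussian and the character factor over coordinates; this leaves the one-dimensional
  formula.\<close>

lemma
  fixes z :: "'a::euclidean_space"
  assumes n: "n > 0"
  shows integrable_gauss: "integrable lborel (gauss n :: 'a \<Rightarrow> real)"
    and fourier_gauss: "fourier (\<lambda>x. complex_of_real (gauss n x)) z = complex_of_real (gauss_hat n z)"
proof -
  interpret product_sigma_finite "\<lambda>_::'a. lborel :: real measure"
    by standard
  have m[measurable]: "(\<lambda>f. \<Sum>b\<in>Basis. f b *\<^sub>R b) \<in> borel_measurable (Pi\<^sub>M (Basis :: 'a set) (\<lambda>_. lborel))"
    by (rule borel_measurable_sum) auto
  have ev: "(\<Sum>b\<in>Basis. f b *\<^sub>R b) \<bullet> c = f c" if "c \<in> Basis" for f :: "'a \<Rightarrow> real" and c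
    using that by simp
  have "integrable (Pi\<^sub>M (Basis :: 'a set) (\<lambda>_. lborel)) (\<lambda>f. \<Prod>b\<in>Basis. exp (- (f b / n)\<^sup>2 / 2))"
    by (intro product_integrable_prod integrable_gaussian n) auto
  then have "integrable (Pi\<^sub>M (Basis :: 'a set) (\<lambda>_. lborel)) (\<lambda>f. gauss n (\<Sum>b\<in>Basis. f b *\<^sub>R b))"
    unfolding gauss_def by (simp add: ev cong: prod.cong)
  then show "integrable lborel (gauss n :: 'a \<Rightarrow> real)"
    by (subst lborel_eq, subst integrable_distr_eq) auto
  have eq: "complex_of_real (gauss n x) * cis (- 2 * pi * (x \<bullet> z))
    = (\<Prod>b\<in>Basis. complex_of_real (exp (- (x \<bullet> b / n)\<^sup>2 / 2)) * cis (- 2 * pi * ((x \<bullet> b) * (z \<bullet> b))))" for x :: 'a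
    by (subst euclidean_inner) (simp add: gauss_def prod.distrib cis_sum[symmetric] sum_distrib_left)
  have "fourier (\<lambda>x. complex_of_real (gauss n x)) z
    = (LINT f|Pi\<^sub>M (Basis :: 'a set) (\<lambda>_. lborel). complex_of_real (gauss n (\<Sum>b\<in>Basis. f b *\<^sub>R b)) * cis (- 2 * pi * ((\<Sum>b\<in>Basis. f b *\<^sub>R b) \<bullet> z)))"
    unfolding fourier_def by (subst lborel_eq, subst integral_distr[OF m]) measurable
  also have "\<dots> = (LINT f|Pi\<^sub>M (Basis :: 'a set) (\<lambda>_. lborel). (\<Prod>b\<in>Basis. complex_of_real (exp (- (f b / n)\<^sup>2 / 2)) * cis (- 2 * pi * (f b * (z \<bullet> b)))))"
    unfolding eq by (simp add: ev cong: prod.cong)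
  also have "\<dots> = (\<Prod>b\<in>Basis. (LINT s|lborel. complex_of_real (exp (- (s / n)\<^sup>2 / 2)) * cis (- 2 * pi * (s * (z \<bullet> b)))))"
  proof (rule product_integral_prod)
    fix b
    have "integrable lborel (\<lambda>s. complex_of_real (exp (- (s / n)\<^sup>2 / 2)))"
      using integrable_gaussian[OF n] by (simp only: complex_of_real_integrable_eq)
    then show "integrable lborel (\<lambda>s. complex_of_real (exp (- (s / n)\<^sup>2 / 2)) * cis (- 2 * pi * (s * (z \<bullet> b))))"
      by (rule Bochner_Integration.integrable_bound) (auto simp: norm_mult)
  qed auto
  also have "\<dots> = complex_of_real (gauss_hat n z)"
    unfolding integral_gaussian_cis[OF n] gauss_hat_def by simp
  finally show "fourier (\<lambda>x. complex_of_real (gauss n x)) z = complex_of_real (gauss_hat n z)" .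
qed

section \<open>Invariance of Lebesgue measure under translation and reflection\<close>

lemma nn_integral_shift:
  fixes f :: "'a::euclidean_space \<Rightarrow> ennreal"
  assumes [measurable]: "f \<in> borel_measurable borel"
  shows "(\<integral>\<^sup>+ x. f (c + x) \<partial>lborel) = (\<integral>\<^sup>+ x. f x \<partial>lborel)"
proof -
  have "(\<integral>\<^sup>+ x. f x \<partial>lborel) = (\<integral>\<^sup>+ x. f x \<partial>distr lborel borel ((+) c))"
    by (simp only: lborel_distr_plus)
  also have "\<dots> = (\<integral>\<^sup>+ x. f (c + x) \<partial>lborel)"
    by (subst nn_integral_distr) auto
  finally show ?thesis by simp
qed

lemma integral_shift:
  fixes f :: "'a::euclidean_space \<Rightarrow> complex"
  assumes [measurable]: "f \<in> borel_measurable borel"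
  shows "(LINT x|lborel. f (c + x)) = (LINT x|lborel. f x)"
proof -
  have "(LINT x|lborel. f x) = (LINT x|distr lborel borel ((+) c). f x)"
    by (simp only: lborel_distr_plus)
  also have "\<dots> = (LINT x|lborel. f (c + x))"
    by (subst integral_distr) auto
  finally show ?thesis by simp
qed

lemma distr_lborel_uminus:
  "distr lborel borel uminus = (lborel :: 'a::euclidean_space measure)"
  by (subst lborel_affine[of "-1" 0]) (auto simp: density_1)

lemma nn_integral_uminus:
  fixes f :: "'a::euclidean_space \<Rightarrow> ennreal"
  assumes [measurable]: "f \<in> borel_measurable borel"
  shows "(\<integral>\<^sup>+ x. f (- x) \<partial>lborel) = (\<integral>\<^sup>+ x. f x \<partial>lborel)"
proof -
  have "(\<integral>\<^sup>+ x. f x \<partial>lborel) = (\<integral>\<^sup>+ x. f x \<partial>distr lborel borel uminus)"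
    by (simp only: distr_lborel_uminus)
  also have "\<dots> = (\<integral>\<^sup>+ x. f (- x) \<partial>lborel)"
    by (subst nn_integral_distr) auto
  finally show ?thesis by simp
qed

lemma integral_uminus:
  fixes f :: "'a::euclidean_space \<Rightarrow> complex"
  assumes [measurable]: "f \<in> borel_measurable borel"
  shows "(LINT x|lborel. f (- x)) = (LINT x|lborel. f x)"
proof -
  have "(LINT x|lborel. f x) = (LINT x|distr lborel borel uminus. f x)"
    by (simp only: distr_lborel_uminus)
  also have "\<dots> = (LINT x|lborel. f (- x))"
    by (subst integral_distr) auto
  finally show ?thesis by simp
qed

lemma measurable_fourier [measurable]:
  assumes [measurable]: "f \<in> borel_measurable borel"
  shows "fourier f \<in> borel_measurable borel"
  unfolding fourier_def by measurable

lemma norm_fourier_le: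
  "norm (fourier f \<xi>) \<le> (LINT x|lborel. norm (f x))"
proof -
  have "norm (fourier f \<xi>) \<le> (LINT x|lborel. norm (f x * cis (- 2 * pi * (x \<bullet> \<xi>))))"
    unfolding fourier_def by (rule integral_norm_bound)
  then show ?thesis by (simp add: norm_mult)
qed

text \<open>The multiplication formula. The kernel has modulus one, so the double integral converges
  absolutely and Fubini applies.\<close>

lemma integral_fourier_mult:
  fixes f g :: "'a::euclidean_space \<Rightarrow> complex"
  assumes f: "integrable lborel f" and g: "integrable lborel g"
  shows "(LINT \<xi>|lborel. fourier f \<xi> * g \<xi>) = (LINT x|lborel. f x * fourier g x)"
proof -
  have [measurable]: "f \<in> borel_measurable borel" "g \<in> borel_measurable borel"
    using f g by (auto dest: borel_measurable_integrable)
  have "integrable (lborel \<Otimes>\<^sub>M lborel) (\<lambda>(x, \<xi>). f x * cis (- 2 * pi * (x \<bullet> \<xi>)) * g \<xi>)"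
  proof (rule integrableI_bounded)
    have "(\<integral>\<^sup>+ z. ennreal (norm ((\<lambda>(x, \<xi>). f x * cis (- 2 * pi * (x \<bullet> \<xi>)) * g \<xi>) z)) \<partial>(lborel \<Otimes>\<^sub>M lborel))
       = (\<integral>\<^sup>+ x. \<integral>\<^sup>+ \<xi>. ennreal (norm (f x)) * ennreal (norm (g \<xi>)) \<partial>lborel \<partial>lborel)"
      by (subst lborel.nn_integral_fst[symmetric])
        (auto simp: norm_mult ennreal_mult)
    also have "\<dots> = (\<integral>\<^sup>+ x. ennreal (norm (f x)) \<partial>lborel) * (\<integral>\<^sup>+ \<xi>. ennreal (norm (g \<xi>)) \<partial>lborel)"
      by (simp add: nn_integral_cmult nn_integral_multc)
    also have "\<dots> < \<infinity>"
      using f g by (auto simp: integrable_iff_bounded ennreal_mult_less_top)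
    finally show "(\<integral>\<^sup>+ z. ennreal (norm ((\<lambda>(x, \<xi>). f x * cis (- 2 * pi * (x \<bullet> \<xi>)) * g \<xi>) z)) \<partial>(lborel \<Otimes>\<^sub>M lborel)) < \<infinity>" .
  qed measurable
  from lborel_pair.Fubini_integral[OF this]
  have "(LINT \<xi>|lborel. LINT x|lborel. f x * cis (- 2 * pi * (x \<bullet> \<xi>)) * g \<xi>)
      = (LINT x|lborel. LINT \<xi>|lborel. f x * (g \<xi> * cis (- 2 * pi * (\<xi> \<bullet> x))))"
    by (simp add: mult_ac inner_commute)
  then show ?thesis unfolding fourier_def
    by simp
qed

text \<open>Two uses of the multiplication formula turn the left side into a pairing of
  \<open>F\<close> with its reflected conjugate smoothed by the probability density
  \<open>gauss_hat n\<close>, and such smoothing does not increase the L2 norm. The Gaussian factor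
  makes all integrals on the frequency side converge.\<close>

lemma nn_integral_gauss_fourier_le:
  fixes F :: "'a::euclidean_space \<Rightarrow> complex"
  assumes F: "integrable lborel F" and n: "n > 0"
  shows "(\<integral>\<^sup>+ \<xi>. ennreal (gauss n \<xi> * (norm (fourier F \<xi>))\<^sup>2) \<partial>lborel)
    \<le> (\<integral>\<^sup>+ x. ennreal ((norm (F x))\<^sup>2) \<partial>lborel)"
proof -
  have [measurable]: "F \<in> borel_measurable borel"
    using F by (auto dest: borel_measurable_integrable)
  define L where "L = (LINT x|lborel. norm (F x))"
  have L: "norm (fourier F \<xi>) \<le> L" for \<xi>
    unfolding L_def by (rule norm_fourier_le)
  have int1: "integrable lborel (\<lambda>\<xi>. complex_of_real (gauss n \<xi>) * cis (- 2 * pi * (x \<bullet> \<xi>)))" for x :: 'a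
    by (rule Bochner_Integration.integrable_bound[OF integrable_gauss[OF n]]) (auto simp: norm_mult gauss_nonneg)
  have int2: "integrable lborel (\<lambda>\<xi>. gauss n \<xi> * L)"
    using integrable_gauss[OF n] by auto
  have int3: "integrable lborel (\<lambda>\<xi>. complex_of_real (gauss n \<xi>) * cnj (fourier F \<xi>))"
  proof (rule Bochner_Integration.integrable_bound[OF int2])
    show "AE \<xi> in lborel. norm (complex_of_real (gauss n \<xi>) * cnj (fourier F \<xi>)) \<le> norm (gauss n \<xi> * L)"
      using L by (intro AE_I2) (auto simp: norm_mult abs_mult gauss_nonneg intro!: mult_left_mono intro: order_trans[OF L])
  qed measurable
  have int4: "integrable lborel (\<lambda>\<xi>. gauss n \<xi> * (norm (fourier F \<xi>))\<^sup>2)"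
  proof (rule Bochner_Integration.integrable_bound)
    show "integrable lborel (\<lambda>\<xi>::'a. gauss n \<xi> * L\<^sup>2)"
      using integrable_gauss[OF n] by auto
    show "AE \<xi> in lborel. norm (gauss n \<xi> * (norm (fourier F \<xi>))\<^sup>2) \<le> norm (gauss n \<xi> * L\<^sup>2)"
      using L by (intro AE_I2) (auto simp: abs_mult gauss_nonneg power_mono intro!: mult_left_mono)
  qed measurable
  \<comment> \<open>Reflecting and conjugating a function conjugates its transform, so
    \<open>cnj (fourier F \<xi>)\<close> is itself a transform and the multiplication formula
    applies to it.\<close>
  define G where "G y = cnj (F (- y))" for y
  have [measurable]: "G \<in> borel_measurable borel" unfolding G_def by measurable
  have G: "integrable lborel G"
    using F nn_integral_uminus[of "\<lambda>x. ennreal (norm (F x))"]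
    by (simp add: integrable_iff_bounded G_def)
  have fG: "fourier G \<xi> = cnj (fourier F \<xi>)" for \<xi>
  proof -
    have "cnj (fourier F \<xi>) = (LINT x|lborel. cnj (F x) * cis (2 * pi * (x \<bullet> \<xi>)))"
    proof -
      have "bounded_linear cnj" by (rule bounded_linear_cnj)
      moreover have "integrable lborel (\<lambda>x. F x * cis (- 2 * pi * (x \<bullet> \<xi>)))"
        by (rule Bochner_Integration.integrable_bound[OF F]) (auto simp: norm_mult)
      ultimately have "cnj (fourier F \<xi>) = (LINT x|lborel. cnj (F x * cis (- 2 * pi * (x \<bullet> \<xi>))))"
        unfolding fourier_def by (rule integral_bounded_linear[symmetric])
      then show ?thesis by (simp add: cis_cnj)
    qed
    also have "\<dots> = fourier G \<xi>"
      unfolding fourier_def G_def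
      by (subst integral_uminus[symmetric]) simp_all
    finally show ?thesis by simp
  qed
  have H: "fourier (\<lambda>\<xi>. complex_of_real (gauss n \<xi>) * cnj (fourier F \<xi>)) x
      = (LINT y|lborel. G y * complex_of_real (gauss_hat n (x + y)))" for x
  proof -
    have "fourier (\<lambda>\<xi>. complex_of_real (gauss n \<xi>) * cnj (fourier F \<xi>)) x
      = (LINT \<xi>|lborel. fourier G \<xi> * (complex_of_real (gauss n \<xi>) * cis (- 2 * pi * (x \<bullet> \<xi>))))"
      unfolding fG by (subst fourier_def) (simp add: mult_ac inner_commute)
    also have "\<dots> = (LINT y|lborel. G y * fourier (\<lambda>\<xi>. complex_of_real (gauss n \<xi>) * cis (- 2 * pi * (x \<bullet> \<xi>))) y)"
      by (rule integral_fourier_mult[OF G int1])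
    also have "(\<lambda>y. fourier (\<lambda>\<xi>. complex_of_real (gauss n \<xi>) * cis (- 2 * pi * (x \<bullet> \<xi>))) y)
        = (\<lambda>y. complex_of_real (gauss_hat n (x + y)))"
      unfolding fourier_gauss[OF n, symmetric] fourier_def
      by (intro ext Bochner_Integration.integral_cong)
        (auto simp: cis_mult inner_add algebra_simps inner_commute)
    finally show ?thesis .
  qed
  have "complex_of_real (LINT \<xi>|lborel. gauss n \<xi> * (norm (fourier F \<xi>))\<^sup>2)
      = (LINT \<xi>|lborel. fourier F \<xi> * (complex_of_real (gauss n \<xi>) * cnj (fourier F \<xi>)))"
    by (subst integral_complex_of_real[symmetric])
       (simp add: complex_norm_square mult_ac del: of_real_power)
  also have "\<dots> = (LINT x|lborel. F x * (LINT y|lborel. G y * complex_of_real (gauss_hat n (x + y))))"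
    unfolding H[symmetric] by (rule integral_fourier_mult[OF F int3])
  finally have eq: "complex_of_real (LINT \<xi>|lborel. gauss n \<xi> * (norm (fourier F \<xi>))\<^sup>2) = \<dots>" .
  have "(\<integral>\<^sup>+ \<xi>. ennreal (gauss n \<xi> * (norm (fourier F \<xi>))\<^sup>2) \<partial>lborel)
     = ennreal (LINT \<xi>|lborel. gauss n \<xi> * (norm (fourier F \<xi>))\<^sup>2)"
    using int4 by (intro nn_integral_eq_integral) (auto simp: gauss_nonneg)
  also have "\<dots> = ennreal (norm (complex_of_real (LINT \<xi>|lborel. gauss n \<xi> * (norm (fourier F \<xi>))\<^sup>2)))"
    by (simp add: gauss_nonneg integral_nonneg_AE)
  also have "\<dots> \<le> (\<integral>\<^sup>+ x. ennreal (norm (F x * (LINT y|lborel. G y * complex_of_real (gauss_hat n (x + y))))) \<partial>lborel)"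
    unfolding eq by (rule norm_integral_le_nn_integral)
  also have "\<dots> \<le> (\<integral>\<^sup>+ x. ennreal (norm (F x)) * (\<integral>\<^sup>+ y. ennreal (norm (G y * complex_of_real (gauss_hat n (x + y)))) \<partial>lborel) \<partial>lborel)"
    by (intro nn_integral_mono) (auto simp: norm_mult ennreal_mult intro!: mult_left_mono norm_integral_le_nn_integral[THEN order_trans])
  also have "\<dots> = (\<integral>\<^sup>+ x. \<integral>\<^sup>+ y. ennreal (norm (F x) * norm (G y)) * ennreal (gauss_hat n (x + y)) \<partial>lborel \<partial>lborel)"
    by (subst nn_integral_cmult[symmetric]) (auto simp: norm_mult ennreal_mult mult_ac gauss_hat_nonneg)
  \<comment> \<open>Schur's test: after \<open>2 * a * b \<le> a\<^sup>2 + b\<^sup>2\<close> each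
    summand contains only one of the two functions, and the kernel integrates to 1 in the other
    variable.\<close>
  also have "\<dots> \<le> (\<integral>\<^sup>+ x. \<integral>\<^sup>+ y. (ennreal ((norm (F x))\<^sup>2 / 2) * ennreal (gauss_hat n (x + y)) + ennreal ((norm (G y))\<^sup>2 / 2) * ennreal (gauss_hat n (x + y))) \<partial>lborel \<partial>lborel)"
  proof (intro nn_integral_mono)
    fix x y
    have "0 \<le> (norm (F x) - norm (G y))\<^sup>2" by simp
    then have "norm (F x) * norm (G y) \<le> (norm (F x))\<^sup>2 / 2 + (norm (G y))\<^sup>2 / 2"
      by (simp add: power2_diff)
    then have "ennreal (norm (F x) * norm (G y)) \<le> ennreal ((norm (F x))\<^sup>2 / 2) + ennreal ((norm (G y))\<^sup>2 / 2)"
      by (simp add: ennreal_plus[symmetric] ennreal_leI del: ennreal_plus)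
    then show "ennreal (norm (F x) * norm (G y)) * ennreal (gauss_hat n (x + y)) \<le>
      ennreal ((norm (F x))\<^sup>2 / 2) * ennreal (gauss_hat n (x + y)) + ennreal ((norm (G y))\<^sup>2 / 2) * ennreal (gauss_hat n (x + y))"
      unfolding distrib_right[symmetric] by (intro mult_right_mono) auto
  qed
  also have "\<dots> = (\<integral>\<^sup>+ x. \<integral>\<^sup>+ y. ennreal ((norm (F x))\<^sup>2 / 2) * ennreal (gauss_hat n (x + y)) \<partial>lborel \<partial>lborel)
      + (\<integral>\<^sup>+ x. \<integral>\<^sup>+ y. ennreal ((norm (G y))\<^sup>2 / 2) * ennreal (gauss_hat n (x + y)) \<partial>lborel \<partial>lborel)"
    by (simp add: nn_integral_add)
  also have "(\<integral>\<^sup>+ x. \<integral>\<^sup>+ y. ennreal ((norm (F x))\<^sup>2 / 2) * ennreal (gauss_hat n (x + y)) \<partial>lborel \<partial>lborel)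
      = (\<integral>\<^sup>+ x. ennreal ((norm (F x))\<^sup>2 / 2) \<partial>lborel)"
    using nn_integral_shift[of "\<lambda>z::'a. ennreal (gauss_hat n z)"]
    by (simp add: nn_integral_cmult nn_integral_gauss_hat n)
  also have "(\<integral>\<^sup>+ x. \<integral>\<^sup>+ y. ennreal ((norm (G y))\<^sup>2 / 2) * ennreal (gauss_hat n (x + y)) \<partial>lborel \<partial>lborel)
      = (\<integral>\<^sup>+ y. \<integral>\<^sup>+ x. ennreal ((norm (G y))\<^sup>2 / 2) * ennreal (gauss_hat n (x + y)) \<partial>lborel \<partial>lborel)"
    by (rule lborel_pair.Fubini') measurable
  also have "\<dots> = (\<integral>\<^sup>+ x. ennreal ((norm (G x))\<^sup>2 / 2) \<partial>lborel)"
    using nn_integral_shift[of "\<lambda>z::'a. ennreal (gauss_hat n z)"]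
    by (simp add: nn_integral_cmult nn_integral_gauss_hat n add.commute)
  also have "\<dots> = (\<integral>\<^sup>+ x. ennreal ((norm (F x))\<^sup>2 / 2) \<partial>lborel)"
    using nn_integral_uminus[of "\<lambda>x. ennreal ((norm (F x))\<^sup>2 / 2)"] by (simp add: G_def)
  also have "(\<integral>\<^sup>+ x. ennreal ((norm (F x))\<^sup>2 / 2) \<partial>lborel) + (\<integral>\<^sup>+ x. ennreal ((norm (F x))\<^sup>2 / 2) \<partial>lborel)
     = (\<integral>\<^sup>+ x. ennreal ((norm (F x))\<^sup>2) \<partial>lborel)"
    by (subst nn_integral_add[symmetric]) (auto simp: ennreal_plus[symmetric] simp del: ennreal_plus)
  finally show ?thesis .
qed

text \<open>Fatou's lemma removes the Gaussian. This half of Plancherel serves twice: it passes from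
  the data to their transforms, and from a frequency density to the output of the bilinear operator.
  An infinite right side is allowed.\<close>

theorem nn_integral_fourier_le:
  fixes F :: "'a::euclidean_space \<Rightarrow> complex"
  assumes F: "integrable lborel F"
  shows "(\<integral>\<^sup>+ \<xi>. ennreal ((norm (fourier F \<xi>))\<^sup>2) \<partial>lborel)
    \<le> (\<integral>\<^sup>+ x. ennreal ((norm (F x))\<^sup>2) \<partial>lborel)"
proof -
  have [measurable]: "F \<in> borel_measurable borel"
    using F by (auto dest: borel_measurable_integrable)
  \<comment> \<open>\<open>Suc i\<close> keeps the width of the Gaussian positive from the first
    term on.\<close>
  have lim: "(\<lambda>i. ennreal (gauss (real (Suc i)) \<xi> * (norm (fourier F \<xi>))\<^sup>2)) \<longlonglongrightarrow> ennreal ((norm (fourier F \<xi>))\<^sup>2)" for \<xi>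
  proof -
    have "(\<lambda>i. gauss (real (Suc i)) \<xi>) \<longlonglongrightarrow> (\<Prod>b\<in>(Basis :: 'a set). exp (- 0\<^sup>2 / 2))"
      unfolding gauss_def
      by (intro tendsto_intros real_tendsto_divide_at_top[OF tendsto_const]
          filterlim_compose[OF filterlim_real_sequentially filterlim_Suc]) auto
    then have "(\<lambda>i. gauss (real (Suc i)) \<xi>) \<longlonglongrightarrow> 1" by simp
    then have "(\<lambda>i. ennreal (gauss (real (Suc i)) \<xi> * (norm (fourier F \<xi>))\<^sup>2)) \<longlonglongrightarrow> ennreal (1 * (norm (fourier F \<xi>))\<^sup>2)"
      by (intro tendsto_ennrealI tendsto_mult tendsto_const)
    then show ?thesis by simp
  qed
  have "(\<integral>\<^sup>+ \<xi>. ennreal ((norm (fourier F \<xi>))\<^sup>2) \<partial>lborel)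
     = (\<integral>\<^sup>+ \<xi>. liminf (\<lambda>i. ennreal (gauss (real (Suc i)) \<xi> * (norm (fourier F \<xi>))\<^sup>2)) \<partial>lborel)"
    using lim_imp_Liminf[OF sequentially_bot lim] by simp
  also have "\<dots> \<le> liminf (\<lambda>i. \<integral>\<^sup>+ \<xi>. ennreal (gauss (real (Suc i)) \<xi> * (norm (fourier F \<xi>))\<^sup>2) \<partial>lborel)"
    by (rule nn_integral_liminf) measurable
  also have "\<dots> \<le> liminf (\<lambda>i. \<integral>\<^sup>+ x. ennreal ((norm (F x))\<^sup>2) \<partial>lborel)"
    by (intro Liminf_mono always_eventually allI nn_integral_gauss_fourier_le F) simp
  also have "\<dots> = (\<integral>\<^sup>+ x. ennreal ((norm (F x))\<^sup>2) \<partial>lborel)"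
    by (simp add: Liminf_const)
  finally show ?thesis .
qed

section \<open>Compactly supported bilinear multipliers\<close>

text \<open>\<open>bilinear_op\<close> seen from the frequency side: free functions \<open>u\<close>
  and \<open>v\<close> stand in place of the transforms, so that a factor of a transform can be
  moved into the symbol.\<close>

definition bilin ::
  "('a::euclidean_space \<Rightarrow> complex) \<Rightarrow> ('a \<Rightarrow> complex) \<Rightarrow> ('a \<times> 'a \<Rightarrow> complex) \<Rightarrow> 'a \<Rightarrow> complex"
  where "bilin u v \<mu> x =
     (LINT (\<xi>, \<eta>)|lborel. u \<xi> * v \<eta> * \<mu> (\<xi>, \<eta>) * cis (2 * pi * (x \<bullet> (\<xi> + \<eta>))))"

lemma bilin_integrable_iff:
  fixes u v :: "'a::euclidean_space \<Rightarrow> complex"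
  assumes [measurable]: "u \<in> borel_measurable borel" "v \<in> borel_measurable borel"
    "\<mu> \<in> borel_measurable borel"
  shows "integrable lborel (\<lambda>(\<xi>, \<eta>). u \<xi> * v \<eta> * \<mu> (\<xi>, \<eta>) * cis (2 * pi * (x \<bullet> (\<xi> + \<eta>))))
    \<longleftrightarrow> integrable lborel (\<lambda>(\<xi>, \<eta>). u \<xi> * v \<eta> * \<mu> (\<xi>, \<eta>))"
  by (intro iffI; erule Bochner_Integration.integrable_bound)
     (auto simp: norm_mult borel_prod[symmetric])

lemma cball_measurable [measurable]: "cball (c :: 'a::euclidean_space) r \<in> sets borel"
  by (intro borel_closed closed_cball)

text \<open>Only finiteness matters here, so \<open>y \<le> y\<^sup>2 + 1\<close> on a set of finite
  measure suffices.\<close>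

lemma L1_cball_le_L2:
  fixes u :: "'a::euclidean_space \<Rightarrow> complex"
  assumes [measurable]: "u \<in> borel_measurable borel"
    and fin: "(\<integral>\<^sup>+ x. ennreal ((norm (u x))\<^sup>2) \<partial>lborel) < \<infinity>"
  shows "(\<integral>\<^sup>+ x. ennreal (norm (u x)) * indicator (cball 0 r) x \<partial>lborel) < \<infinity>"
proof -
  have "(\<integral>\<^sup>+ x. ennreal (norm (u x)) * indicator (cball 0 r) x \<partial>lborel)
    \<le> (\<integral>\<^sup>+ x. ennreal ((norm (u x))\<^sup>2) + indicator (cball 0 r) x \<partial>lborel)"
  proof (intro nn_integral_mono)
    fix x
    have "norm (u x) \<le> (norm (u x))\<^sup>2 + 1"
    proof -
      have "2 * norm (u x) \<le> (norm (u x))\<^sup>2 + 1"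
        using zero_le_power2[of "norm (u x) - 1"] by (simp add: power2_diff)
      then show ?thesis using norm_ge_zero[of "u x"] by linarith
    qed
    then have "ennreal (norm (u x)) \<le> ennreal ((norm (u x))\<^sup>2) + 1"
      by (metis ennreal_1 ennreal_leI ennreal_plus zero_le_one zero_le_power2)
    then show "ennreal (norm (u x)) * indicator (cball 0 r) x \<le> ennreal ((norm (u x))\<^sup>2) + indicator (cball 0 r) x"
      by (auto simp: indicator_def)
  qed
  also have "\<dots> = (\<integral>\<^sup>+ x. ennreal ((norm (u x))\<^sup>2) \<partial>lborel) + emeasure lborel (cball 0 r :: 'a set)"
    by (subst nn_integral_add) auto
  also have "\<dots> < \<infinity>"
    using fin emeasure_bounded_finite[of "cball 0 r :: 'a set"] by auto
  finally show ?thesis .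
qed

text \<open>A qualitative fact: it licenses the subtractions and the dominated limits for the
  shells. The quantitative bound is \<open>nn_integral_bilin_le\<close>.\<close>

lemma bilin_integrable:
  fixes u v :: "'a::euclidean_space \<Rightarrow> complex"
  assumes [measurable]: "u \<in> borel_measurable borel" "v \<in> borel_measurable borel"
    "\<mu> \<in> borel_measurable borel"
    and u: "(\<integral>\<^sup>+ x. ennreal ((norm (u x))\<^sup>2) \<partial>lborel) < \<infinity>"
    and v: "(\<integral>\<^sup>+ x. ennreal ((norm (v x))\<^sup>2) \<partial>lborel) < \<infinity>"
    and b: "\<And>z. norm (\<mu> z) \<le> b"
    and r: "\<And>\<xi> \<eta>. \<mu> (\<xi>, \<eta>) \<noteq> 0 \<Longrightarrow> norm \<xi> \<le> r \<and> norm \<eta> \<le> r"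
  shows "integrable lborel (\<lambda>(\<xi>, \<eta>). u \<xi> * v \<eta> * \<mu> (\<xi>, \<eta>))"
proof -
  have [measurable]: "\<mu> \<in> borel_measurable (borel \<Otimes>\<^sub>M borel)" by (simp add: borel_prod)
  have "integrable (lborel \<Otimes>\<^sub>M lborel) (\<lambda>(\<xi>, \<eta>). u \<xi> * v \<eta> * \<mu> (\<xi>, \<eta>))"
  proof (rule integrableI_bounded)
    have "(\<integral>\<^sup>+ z. ennreal (norm ((\<lambda>(\<xi>, \<eta>). u \<xi> * v \<eta> * \<mu> (\<xi>, \<eta>)) z)) \<partial>(lborel \<Otimes>\<^sub>M lborel))
       = (\<integral>\<^sup>+ \<xi>. \<integral>\<^sup>+ \<eta>. ennreal (norm (u \<xi> * v \<eta> * \<mu> (\<xi>, \<eta>))) \<partial>lborel \<partial>lborel)"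
      by (subst lborel.nn_integral_fst[symmetric]) auto
    also have "\<dots> \<le> (\<integral>\<^sup>+ \<xi>. \<integral>\<^sup>+ \<eta>. (ennreal b * (ennreal (norm (u \<xi>)) * indicator (cball 0 r) \<xi>))
         * (ennreal (norm (v \<eta>)) * indicator (cball 0 r) \<eta>) \<partial>lborel \<partial>lborel)"
    proof (intro nn_integral_mono)
      fix \<xi> \<eta>
      have "0 \<le> b" using order_trans[OF norm_ge_zero b] .
      then have "norm (u \<xi> * v \<eta> * \<mu> (\<xi>, \<eta>)) \<le> b * (norm (u \<xi>) * indicator (cball 0 r) \<xi>) * (norm (v \<eta>) * indicator (cball 0 r) \<eta>)"
        using b[of "(\<xi>, \<eta>)"] r[of \<xi> \<eta>]
        by (cases "\<mu> (\<xi>, \<eta>) = 0")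
          (auto simp: norm_mult mult.commute[of b] mult.assoc indicator_def intro!: mult_left_mono)
      then have "ennreal (norm (u \<xi> * v \<eta> * \<mu> (\<xi>, \<eta>))) \<le> ennreal (b * (norm (u \<xi>) * indicator (cball 0 r) \<xi>) * (norm (v \<eta>) * indicator (cball 0 r) \<eta>))"
        by (rule ennreal_leI)
      also have "\<dots> = (ennreal b * (ennreal (norm (u \<xi>)) * indicator (cball 0 r) \<xi>))
         * (ennreal (norm (v \<eta>)) * indicator (cball 0 r) \<eta>)"
        using \<open>0 \<le> b\<close> by (auto simp: indicator_def ennreal_mult)
      finally show "ennreal (norm (u \<xi> * v \<eta> * \<mu> (\<xi>, \<eta>))) \<le> \<dots>" .
    qed
    also have "\<dots> = ennreal b * (\<integral>\<^sup>+ x. ennreal (norm (u x)) * indicator (cball 0 r) x \<partial>lborel)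
       * (\<integral>\<^sup>+ x. ennreal (norm (v x)) * indicator (cball 0 r) x \<partial>lborel)"
      by (simp add: nn_integral_cmult nn_integral_multc)
    also have "\<dots> < \<infinity>"
      using L1_cball_le_L2[of u r] L1_cball_le_L2[of v r] u v
      by (auto simp: ennreal_mult_less_top)
    finally show "(\<integral>\<^sup>+ z. ennreal (norm ((\<lambda>(\<xi>, \<eta>). u \<xi> * v \<eta> * \<mu> (\<xi>, \<eta>)) z)) \<partial>(lborel \<Otimes>\<^sub>M lborel)) < \<infinity>" .
  qed measurable
  then show ?thesis by (simp only: lborel_prod)
qed

text \<open>In the variable \<open>\<zeta> = \<xi> + \<eta>\<close> the operator is a Fourier
  transform of integrals over the slices of constant \<open>\<zeta>\<close>. The slices have
  dimension d, which is why the radius enters as \<open>r ^ DIM('a)\<close> and not with twice that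
  power.\<close>

theorem nn_integral_bilin_le:
  fixes u v :: "'a::euclidean_space \<Rightarrow> complex"
  assumes [measurable]: "u \<in> borel_measurable borel" "v \<in> borel_measurable borel"
    "\<mu> \<in> borel_measurable borel"
    and b: "\<And>z. norm (\<mu> z) \<le> b"
    and r: "\<And>\<xi> \<eta>. \<mu> (\<xi>, \<eta>) \<noteq> 0 \<Longrightarrow> norm \<eta> \<le> r" and r0: "0 \<le> r"
  shows "(\<integral>\<^sup>+ x. ennreal ((norm (bilin u v \<mu> x))\<^sup>2) \<partial>lborel)
    \<le> ennreal (unit_ball_vol (real DIM('a)) * r ^ DIM('a) * b\<^sup>2)
        * (\<integral>\<^sup>+ x. ennreal ((norm (u x))\<^sup>2) \<partial>lborel) * (\<integral>\<^sup>+ x. ennreal ((norm (v x))\<^sup>2) \<partial>lborel)"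
proof (cases "integrable lborel (\<lambda>(\<xi>, \<eta>). u \<xi> * v \<eta> * \<mu> (\<xi>, \<eta>))")
  case False
  \<comment> \<open>The conventional value 0 of a divergent integral makes the left side
    vanish.\<close>
  then have "bilin u v \<mu> x = 0" for x
    unfolding bilin_def by (intro not_integrable_integral_eq) (simp add: bilin_integrable_iff)
  then show ?thesis by simp
next
  case True
  have [measurable]: "\<mu> \<in> borel_measurable (borel \<Otimes>\<^sub>M borel)" by (simp add: borel_prod)
  define K where "K \<xi> \<eta> = u \<xi> * v \<eta> * \<mu> (\<xi>, \<eta>)" for \<xi> \<eta>
  have [measurable]: "case_prod K \<in> borel_measurable (borel \<Otimes>\<^sub>M borel)"
    unfolding K_def by measurable
  have K: "integrable (lborel \<Otimes>\<^sub>M lborel) (case_prod K)"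
    using True unfolding K_def lborel_prod by simp
  have Kx: "integrable (lborel \<Otimes>\<^sub>M lborel) (\<lambda>(\<xi>, \<eta>). K \<xi> \<eta> * cis (2 * pi * (x \<bullet> (\<xi> + \<eta>))))" for x
    by (rule Bochner_Integration.integrable_bound[OF K]) (auto simp: norm_mult split_beta')
  have sh: "(\<integral>\<^sup>+ \<zeta>. f (\<zeta> - \<eta>) \<partial>lborel) = (\<integral>\<^sup>+ \<xi>. f \<xi> \<partial>lborel)"
    if "f \<in> borel_measurable borel" for f :: "'a \<Rightarrow> ennreal" and \<eta>
    using nn_integral_shift[OF that, of "- \<eta>"] by simp
  \<comment> \<open>The shear preserves measure: for fixed \<open>\<eta>\<close> it is a translation
    of the first variable.\<close>
  have K': "integrable (lborel \<Otimes>\<^sub>M lborel) (\<lambda>(\<zeta>, \<eta>). K (\<zeta> - \<eta>) \<eta>)"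
  proof (rule integrableI_bounded)
    have "(\<integral>\<^sup>+ z. ennreal (norm ((\<lambda>(\<zeta>, \<eta>). K (\<zeta> - \<eta>) \<eta>) z)) \<partial>(lborel \<Otimes>\<^sub>M lborel))
      = (\<integral>\<^sup>+ \<eta>. \<integral>\<^sup>+ \<zeta>. ennreal (norm (K (\<zeta> - \<eta>) \<eta>)) \<partial>lborel \<partial>lborel)"
      by (subst lborel_pair.nn_integral_snd[symmetric]) auto
    also have "\<dots> = (\<integral>\<^sup>+ \<eta>. \<integral>\<^sup>+ \<xi>. ennreal (norm (K \<xi> \<eta>)) \<partial>lborel \<partial>lborel)"
      by (intro nn_integral_cong sh) measurable
    also have "\<dots> = (\<integral>\<^sup>+ z. ennreal (norm (case_prod K z)) \<partial>(lborel \<Otimes>\<^sub>M lborel))"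
      by (subst lborel_pair.nn_integral_snd[symmetric]) auto
    also have "\<dots> < \<infinity>" using K by (simp add: integrable_iff_bounded)
    finally show "(\<integral>\<^sup>+ z. ennreal (norm ((\<lambda>(\<zeta>, \<eta>). K (\<zeta> - \<eta>) \<eta>) z)) \<partial>(lborel \<Otimes>\<^sub>M lborel)) < \<infinity>" .
  qed measurable
  have K'x: "integrable (lborel \<Otimes>\<^sub>M lborel) (\<lambda>(\<zeta>, \<eta>). K (\<zeta> - \<eta>) \<eta> * cis (2 * pi * (x \<bullet> \<zeta>)))" for x
    by (rule Bochner_Integration.integrable_bound[OF K']) (auto simp: norm_mult split_beta')
  define H where "H \<zeta> = (LINT \<eta>|lborel. K (\<zeta> - \<eta>) \<eta>)" for \<zeta>
  have H: "integrable lborel H"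
    unfolding H_def by (rule lborel_pair.integrable_fst[OF K'])
  have [measurable]: "H \<in> borel_measurable borel" unfolding H_def by measurable
  \<comment> \<open>The operator carries the character of the inverse transform, hence the sign; it
    disappears under the reflection invariance of the integral.\<close>
  have T: "bilin u v \<mu> x = fourier H (- x)" for x
  proof -
    have "bilin u v \<mu> x = integral\<^sup>L (lborel \<Otimes>\<^sub>M lborel) (\<lambda>(\<xi>, \<eta>). K \<xi> \<eta> * cis (2 * pi * (x \<bullet> (\<xi> + \<eta>))))"
      unfolding bilin_def K_def lborel_prod ..
    also have "\<dots> = (LINT \<eta>|lborel. LINT \<xi>|lborel. K \<xi> \<eta> * cis (2 * pi * (x \<bullet> (\<xi> + \<eta>))))"
      by (rule lborel_pair.integral_snd[OF Kx, symmetric])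
    also have "\<dots> = (LINT \<eta>|lborel. LINT \<zeta>|lborel. K (\<zeta> - \<eta>) \<eta> * cis (2 * pi * (x \<bullet> \<zeta>)))"
    proof -
      have "(LINT \<xi>|lborel. K \<xi> \<eta> * cis (2 * pi * (x \<bullet> (\<xi> + \<eta>)))) = (LINT \<zeta>|lborel. K (\<zeta> - \<eta>) \<eta> * cis (2 * pi * (x \<bullet> \<zeta>)))" for \<eta> :: 'a
        using integral_shift[of "\<lambda>\<xi>. K \<xi> \<eta> * cis (2 * pi * (x \<bullet> (\<xi> + \<eta>)))" "- \<eta>"] by simp
      then show ?thesis by simp
    qed
    also have "\<dots> = (LINT \<zeta>|lborel. LINT \<eta>|lborel. K (\<zeta> - \<eta>) \<eta> * cis (2 * pi * (x \<bullet> \<zeta>)))"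
      by (rule lborel_pair.Fubini_integral[OF K'x])
    also have "\<dots> = fourier H (- x)"
      unfolding fourier_def H_def by (simp add: inner_commute)
    finally show ?thesis .
  qed
  have Hb: "ennreal ((norm (H \<zeta>))\<^sup>2) \<le> (\<integral>\<^sup>+ \<eta>. ennreal ((norm (u (\<zeta> - \<eta>)))\<^sup>2) * ennreal ((norm (v \<eta>))\<^sup>2) \<partial>lborel)
       * ennreal (unit_ball_vol (real DIM('a)) * r ^ DIM('a) * b\<^sup>2)" for \<zeta>
  proof -
    have "ennreal ((norm (H \<zeta>))\<^sup>2) = (ennreal (norm (H \<zeta>)))\<^sup>2" by (simp add: ennreal_power)
    also have "\<dots> \<le> (\<integral>\<^sup>+ \<eta>. ennreal (norm (K (\<zeta> - \<eta>) \<eta>)) \<partial>lborel)\<^sup>2"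
      unfolding H_def by (intro power_mono norm_integral_le_nn_integral) simp
    also have "\<dots> = (\<integral>\<^sup>+ \<eta>. ennreal (norm (u (\<zeta> - \<eta>) * v \<eta>)) * ennreal (norm (\<mu> (\<zeta> - \<eta>, \<eta>))) \<partial>lborel)\<^sup>2"
      unfolding K_def by (simp add: norm_mult ennreal_mult)
    \<comment> \<open>The data form one factor and the symbol the other, so the symbol costs at most
      \<open>b\<^sup>2\<close> times the volume of a ball, uniformly in
      \<open>\<zeta>\<close>.\<close>
    also have "\<dots> \<le> (\<integral>\<^sup>+ \<eta>. (ennreal (norm (u (\<zeta> - \<eta>) * v \<eta>)))\<^sup>2 \<partial>lborel) * (\<integral>\<^sup>+ \<eta>. (ennreal (norm (\<mu> (\<zeta> - \<eta>, \<eta>))))\<^sup>2 \<partial>lborel)"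
      by (rule Cauchy_Schwarz_nn_integral) measurable
    also have "\<dots> \<le> (\<integral>\<^sup>+ \<eta>. ennreal ((norm (u (\<zeta> - \<eta>)))\<^sup>2) * ennreal ((norm (v \<eta>))\<^sup>2) \<partial>lborel)
       * (\<integral>\<^sup>+ \<eta>. ennreal (b\<^sup>2) * indicator (cball 0 r) \<eta> \<partial>(lborel :: 'a measure))"
    proof (rule mult_mono)
      show "(\<integral>\<^sup>+ \<eta>. (ennreal (norm (u (\<zeta> - \<eta>) * v \<eta>)))\<^sup>2 \<partial>lborel) \<le> (\<integral>\<^sup>+ \<eta>. ennreal ((norm (u (\<zeta> - \<eta>)))\<^sup>2) * ennreal ((norm (v \<eta>))\<^sup>2) \<partial>lborel)"
        by (simp add: ennreal_power norm_mult ennreal_mult power_mult_distrib)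
      show "(\<integral>\<^sup>+ \<eta>. (ennreal (norm (\<mu> (\<zeta> - \<eta>, \<eta>))))\<^sup>2 \<partial>lborel) \<le> (\<integral>\<^sup>+ \<eta>. ennreal (b\<^sup>2) * indicator (cball 0 r) \<eta> \<partial>(lborel :: 'a measure))"
      proof (intro nn_integral_mono)
        fix \<eta>
        have "norm (\<mu> (\<zeta> - \<eta>, \<eta>)) \<le> b * indicator (cball 0 r) \<eta>"
          using b[of "(\<zeta> - \<eta>, \<eta>)"] r[of "\<zeta> - \<eta>" \<eta>] by (cases "\<mu> (\<zeta> - \<eta>, \<eta>) = 0")
             (auto simp: indicator_def)
        then have "ennreal ((norm (\<mu> (\<zeta> - \<eta>, \<eta>)))\<^sup>2) \<le> ennreal ((b * indicator (cball 0 r) \<eta>)\<^sup>2)"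
          by (intro ennreal_leI power_mono) auto
        then show "(ennreal (norm (\<mu> (\<zeta> - \<eta>, \<eta>))))\<^sup>2 \<le> ennreal (b\<^sup>2) * indicator (cball 0 r) \<eta>"
          by (auto simp: ennreal_power indicator_def split: if_splits)
      qed
    qed auto
    also have "(\<integral>\<^sup>+ \<eta>. ennreal (b\<^sup>2) * indicator (cball 0 r) \<eta> \<partial>(lborel :: 'a measure)) = ennreal (unit_ball_vol (real DIM('a)) * r ^ DIM('a) * b\<^sup>2)"
      using r0 by (subst nn_integral_cmult_indicator)
        (auto simp: emeasure_cball ennreal_mult''[symmetric] mult.commute)
    finally show ?thesis .
  qed
  have "(\<integral>\<^sup>+ x. ennreal ((norm (bilin u v \<mu> x))\<^sup>2) \<partial>lborel) = (\<integral>\<^sup>+ x. ennreal ((norm (fourier H x))\<^sup>2) \<partial>lborel)"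
    unfolding T by (rule nn_integral_uminus[of "\<lambda>x. ennreal ((norm (fourier H x))\<^sup>2)"]) measurable
  also have "\<dots> \<le> (\<integral>\<^sup>+ \<zeta>. ennreal ((norm (H \<zeta>))\<^sup>2) \<partial>lborel)"
    by (rule nn_integral_fourier_le[OF H])
  also have "\<dots> \<le> (\<integral>\<^sup>+ \<zeta>. (\<integral>\<^sup>+ \<eta>. ennreal ((norm (u (\<zeta> - \<eta>)))\<^sup>2) * ennreal ((norm (v \<eta>))\<^sup>2) \<partial>lborel)
       * ennreal (unit_ball_vol (real DIM('a)) * r ^ DIM('a) * b\<^sup>2) \<partial>lborel)"
    by (intro nn_integral_mono Hb)
  also have "\<dots> = (\<integral>\<^sup>+ \<zeta>. \<integral>\<^sup>+ \<eta>. ennreal ((norm (u (\<zeta> - \<eta>)))\<^sup>2) * ennreal ((norm (v \<eta>))\<^sup>2) \<partial>lborel \<partial>lborel)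
       * ennreal (unit_ball_vol (real DIM('a)) * r ^ DIM('a) * b\<^sup>2)"
    by (rule nn_integral_multc) measurable
  also have "(\<integral>\<^sup>+ \<zeta>. \<integral>\<^sup>+ \<eta>. ennreal ((norm (u (\<zeta> - \<eta>)))\<^sup>2) * ennreal ((norm (v \<eta>))\<^sup>2) \<partial>lborel \<partial>lborel)
     = (\<integral>\<^sup>+ \<eta>. \<integral>\<^sup>+ \<zeta>. ennreal ((norm (u (\<zeta> - \<eta>)))\<^sup>2) * ennreal ((norm (v \<eta>))\<^sup>2) \<partial>lborel \<partial>lborel)"
    by (rule lborel_pair.Fubini') measurable
  also have "\<dots> = (\<integral>\<^sup>+ x. ennreal ((norm (u x))\<^sup>2) \<partial>lborel) * (\<integral>\<^sup>+ x. ennreal ((norm (v x))\<^sup>2) \<partial>lborel)"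
    using sh[of "\<lambda>x. ennreal ((norm (u x))\<^sup>2)"]
    by (simp add: nn_integral_multc nn_integral_cmult)
  finally show ?thesis by (simp add: mult_ac)
qed

section \<open>Dyadic discretization of the dilation parameter\<close>

text \<open>Cauchy-Schwarz with weights \<open>\<theta> ^ i\<close>, whose reciprocals sum to
  \<open>\<theta> / (\<theta> - 1)\<close>. It is used both along the chain in the dilation
  parameter and across the shells. Only convergence of the partial sums is assumed, as this is what
  dominated convergence provides there.\<close>

lemma weighted_Cauchy_Schwarz:
  fixes d :: "nat \<Rightarrow> complex"
  assumes \<theta>: "\<theta> > 1" and lim: "(\<lambda>n. \<Sum>i<n. d i) \<longlonglongrightarrow> z"
  shows "ennreal ((norm z)\<^sup>2) \<le> ennreal (\<theta> / (\<theta> - 1)) * (\<Sum>i. ennreal (\<theta> ^ i * (norm (d i))\<^sup>2))"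
proof (rule tendsto_upperbound)
  show "(\<lambda>n. ennreal ((norm (\<Sum>i<n. d i))\<^sup>2)) \<longlonglongrightarrow> ennreal ((norm z)\<^sup>2)"
    by (intro tendsto_intros lim)
  show "\<forall>\<^sub>F n in sequentially. ennreal ((norm (\<Sum>i<n. d i))\<^sup>2)
      \<le> ennreal (\<theta> / (\<theta> - 1)) * (\<Sum>i. ennreal (\<theta> ^ i * (norm (d i))\<^sup>2))"
  proof (intro always_eventually allI)
    fix n
    have eq: "norm (d i) = sqrt ((1 / \<theta>) ^ i) * sqrt (\<theta> ^ i * (norm (d i))\<^sup>2)" for i
      using \<theta> by (simp add: real_sqrt_mult[symmetric] power_divide)
    have "(norm (\<Sum>i<n. d i))\<^sup>2 \<le> (\<Sum>i<n. norm (d i))\<^sup>2"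
      by (intro power_mono norm_sum) auto
    also have "\<dots> = (\<Sum>i<n. sqrt ((1 / \<theta>) ^ i) * sqrt (\<theta> ^ i * (norm (d i))\<^sup>2))\<^sup>2"
      using eq by (simp cong: sum.cong)
    also have "\<dots> \<le> (\<Sum>i<n. (sqrt ((1 / \<theta>) ^ i))\<^sup>2) * (\<Sum>i<n. (sqrt (\<theta> ^ i * (norm (d i))\<^sup>2))\<^sup>2)"
      by (rule Cauchy_Schwarz_ineq_sum)
    also have "\<dots> = (\<Sum>i<n. (1 / \<theta>) ^ i) * (\<Sum>i<n. \<theta> ^ i * (norm (d i))\<^sup>2)"
      using \<theta> by simp
    also have "\<dots> \<le> \<theta> / (\<theta> - 1) * (\<Sum>i<n. \<theta> ^ i * (norm (d i))\<^sup>2)"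
    proof (rule mult_right_mono)
      have "(\<Sum>i<n. (1 / \<theta>) ^ i) \<le> (\<Sum>i. (1 / \<theta>) ^ i)"
        using \<theta> by (intro sum_le_suminf summable_geometric) auto
      also have "\<dots> = \<theta> / (\<theta> - 1)"
        using \<theta> by (subst suminf_geometric) (auto simp: field_simps)
      finally show "(\<Sum>i<n. (1 / \<theta>) ^ i) \<le> \<theta> / (\<theta> - 1)" .
      show "0 \<le> (\<Sum>i<n. \<theta> ^ i * (norm (d i))\<^sup>2)"
        using \<theta> by (intro sum_nonneg) auto
    qed
    finally have "ennreal ((norm (\<Sum>i<n. d i))\<^sup>2) \<le> ennreal (\<theta> / (\<theta> - 1) * (\<Sum>i<n. \<theta> ^ i * (norm (d i))\<^sup>2))"
      by (rule ennreal_leI)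
    also have "\<dots> = ennreal (\<theta> / (\<theta> - 1)) * (\<Sum>i<n. ennreal (\<theta> ^ i * (norm (d i))\<^sup>2))"
      using \<theta> by (subst ennreal_mult) (auto simp: sum_ennreal sum_nonneg)
    also have "\<dots> \<le> ennreal (\<theta> / (\<theta> - 1)) * (\<Sum>i. ennreal (\<theta> ^ i * (norm (d i))\<^sup>2))"
      by (intro mult_left_mono sum_le_suminf) auto
    finally show "ennreal ((norm (\<Sum>i<n. d i))\<^sup>2)
      \<le> ennreal (\<theta> / (\<theta> - 1)) * (\<Sum>i. ennreal (\<theta> ^ i * (norm (d i))\<^sup>2))" .
  qed
qed simp

section \<open>Rounding down to dyadic grids and counting grid points\<close>

definition dyadic :: "nat \<Rightarrow> real \<Rightarrow> real" where
  "dyadic k t = real_of_int \<lfloor>2 ^ k * t\<rfloor> / 2 ^ k"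

lemma dyadic_bounds: "dyadic k t \<le> t" "t \<le> dyadic k t + 1 / 2 ^ k"
proof -
  have "real_of_int \<lfloor>2 ^ k * t\<rfloor> \<le> 2 ^ k * t" by simp
  then show "dyadic k t \<le> t" by (simp add: dyadic_def field_simps)
  have "2 ^ k * t \<le> real_of_int \<lfloor>2 ^ k * t\<rfloor> + 1" by linarith
  then have "t \<le> (real_of_int \<lfloor>2 ^ k * t\<rfloor> + 1) / 2 ^ k" by (simp add: field_simps)
  then show "t \<le> dyadic k t + 1 / 2 ^ k" by (simp add: dyadic_def add_divide_distrib)
qed

text \<open>The endpoint 1 lies on every grid, so rounding down cannot leave the interval. A rounded
  point may well leave E, which is why the multiplier bounds are later imposed on all of
  \<open>{1..2}\<close>.\<close>

lemma dyadic_mem: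
  assumes "t \<in> {1..2}"
  shows "dyadic k t \<in> {1..2}"
proof -
  have "(2 ^ k :: real) \<le> 2 ^ k * t" using assms by simp
  then have "(2 ^ k :: int) \<le> \<lfloor>2 ^ k * t\<rfloor>" by (simp add: le_floor_iff)
  then have "(2 ^ k :: real) \<le> real_of_int \<lfloor>2 ^ k * t\<rfloor>" by (metis of_int_le_iff of_int_numeral of_int_power)
  then have "1 \<le> dyadic k t" by (simp add: dyadic_def)
  then show ?thesis using dyadic_bounds(1)[of k t] assms by simp
qed

text \<open>The grids are nested and all rounding goes down, so the coarse approximation can be
  recovered from the fine one alone. This keeps the number of links of the chain at the number of
  fine points, instead of a number of pairs.\<close>

lemma dyadic_dyadic_Suc: "dyadic k (dyadic (Suc k) t) = dyadic k t"
proof -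
  have "\<lfloor>2 ^ k * (real_of_int \<lfloor>2 ^ Suc k * t\<rfloor> / 2 ^ Suc k)\<rfloor> = \<lfloor>2 ^ k * t\<rfloor>"
  proof -
    have "2 ^ k * (real_of_int \<lfloor>2 ^ Suc k * t\<rfloor> / 2 ^ Suc k) = real_of_int \<lfloor>2 * (2 ^ k * t)\<rfloor> / 2"
      by (simp add: mult.assoc)
    moreover have "\<lfloor>real_of_int \<lfloor>2 * y\<rfloor> / 2\<rfloor> = \<lfloor>y\<rfloor>" for y :: real
    proof (rule floor_unique)
      have "of_int (2 * \<lfloor>y\<rfloor>) \<le> 2 * y" by simp
      then have "2 * \<lfloor>y\<rfloor> \<le> \<lfloor>2 * y\<rfloor>" by (simp only: le_floor_iff)
      then show "real_of_int \<lfloor>y\<rfloor> \<le> real_of_int \<lfloor>2 * y\<rfloor> / 2" by linarith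
      show "real_of_int \<lfloor>2 * y\<rfloor> / 2 < real_of_int \<lfloor>y\<rfloor> + 1" by linarith
    qed
    ultimately show ?thesis by simp
  qed
  then show ?thesis by (simp only: dyadic_def)
qed

lemma dyadic_tendsto: "(\<lambda>n. dyadic (j + n) t) \<longlonglongrightarrow> t"
proof (rule tendsto_sandwich)
  have "(\<lambda>n. (1 / 2 :: real) ^ (j + n)) \<longlonglongrightarrow> 0"
    unfolding power_add by (intro tendsto_mult_right_zero LIMSEQ_power_zero) simp
  from tendsto_diff[OF tendsto_const this, of t]
  show "(\<lambda>n. t - (1 / 2) ^ (j + n)) \<longlonglongrightarrow> t" by simp
  show "(\<lambda>n. t) \<longlonglongrightarrow> t" by simp
  show "\<forall>\<^sub>F n in sequentially. t - (1 / 2) ^ (j + n) \<le> dyadic (j + n) t"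
  proof (intro always_eventually allI)
    fix n show "t - (1 / 2) ^ (j + n) \<le> dyadic (j + n) t"
      using dyadic_bounds(2)[of t "j + n"] by (simp add: power_one_over)
  qed
qed (auto intro!: always_eventually dyadic_bounds)

lemma finite_dyadic_image:
  assumes "E \<subseteq> {1..2}"
  shows "finite (dyadic k ` E)" and "card (dyadic k ` E) \<le> 2 ^ k + 1"
proof -
  let ?S = "{2 ^ k .. 2 * 2 ^ k :: int}"
  have sub: "dyadic k ` E \<subseteq> (\<lambda>i. real_of_int i / 2 ^ k) ` ?S"
  proof (intro image_subsetI)
    fix t assume "t \<in> E"
    then have t: "1 \<le> t" "t \<le> 2" using assms by auto
    have "(2 ^ k :: real) \<le> 2 ^ k * t" "2 ^ k * t \<le> 2 ^ k * 2"
      using t by (simp, intro mult_left_mono, auto)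
    then have "2 ^ k \<le> \<lfloor>2 ^ k * t\<rfloor>" "\<lfloor>2 ^ k * t\<rfloor> \<le> \<lfloor>2 * 2 ^ k :: real\<rfloor>"
      by (simp add: le_floor_iff, intro floor_mono, simp)
    moreover have "\<lfloor>2 * 2 ^ k :: real\<rfloor> = 2 * 2 ^ k"
      using floor_of_int[of "2 * 2 ^ k", where 'a=real] by simp
    ultimately have "\<lfloor>2 ^ k * t\<rfloor> \<in> ?S" by simp
    then show "dyadic k t \<in> (\<lambda>i. real_of_int i / 2 ^ k) ` ?S"
      unfolding dyadic_def by (rule imageI)
  qed
  then show "finite (dyadic k ` E)" by (rule finite_subset) simp
  have "card (dyadic k ` E) \<le> card ((\<lambda>i. real_of_int i / 2 ^ k) ` ?S)"
    by (intro card_mono sub) simp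
  also have "\<dots> \<le> card ?S" by (rule card_image_le) simp
  also have "\<dots> = nat (2 ^ k + 1)" by simp
  also have "\<dots> = 2 ^ k + 1" by (simp add: nat_add_distrib nat_power_eq)
  finally show "card (dyadic k ` E) \<le> 2 ^ k + 1" .
qed

text \<open>A closed interval of length equal to the mesh meets at most two adjacent grid
  cells.\<close>

lemma card_dyadic_le_covering_number:
  assumes "E \<subseteq> {1..2}"
  shows "card (dyadic k ` E) \<le> 2 * covering_number E (1 / 2 ^ k)"
proof -
  \<comment> \<open>The rounded points give one finite cover, so the \<open>LEAST\<close> in
    \<open>covering_number\<close> is attained by an actual cover.\<close>
  have "E \<subseteq> (\<Union>c\<in>dyadic k ` E. {c..c + 1 / 2 ^ k})"
    using dyadic_bounds by auto
  then have "\<exists>n S. finite S \<and> card S = n \<and> E \<subseteq> (\<Union>c\<in>S. {c..c + 1 / 2 ^ k})"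
    using finite_dyadic_image[OF assms] by blast
  from LeastI_ex[OF this] obtain S where S: "finite S" "card S = covering_number E (1 / 2 ^ k)"
    "E \<subseteq> (\<Union>c\<in>S. {c..c + 1 / 2 ^ k})"
    unfolding covering_number_def by blast
  have "dyadic k ` E \<subseteq> dyadic k ` S \<union> (\<lambda>c. dyadic k c + 1 / 2 ^ k) ` S"
  proof (intro image_subsetI)
    fix t assume "t \<in> E"
    then obtain c where c: "c \<in> S" "c \<le> t" "t \<le> c + 1 / 2 ^ k" using S by auto
    have "2 ^ k * c \<le> 2 ^ k * t" using c by (intro mult_left_mono) auto
    moreover have "2 ^ k * t \<le> 2 ^ k * (c + 1 / 2 ^ k)" using c by (intro mult_left_mono) auto
    then have "2 ^ k * t \<le> 2 ^ k * c + 1" by (simp add: distrib_left)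
    ultimately have "\<lfloor>2 ^ k * t\<rfloor> = \<lfloor>2 ^ k * c\<rfloor> \<or> \<lfloor>2 ^ k * t\<rfloor> = \<lfloor>2 ^ k * c\<rfloor> + 1" by linarith
    then have "dyadic k t = dyadic k c \<or> dyadic k t = dyadic k c + 1 / 2 ^ k"
      by (auto simp: dyadic_def add_divide_distrib)
    then show "dyadic k t \<in> dyadic k ` S \<union> (\<lambda>c. dyadic k c + 1 / 2 ^ k) ` S" using c by auto
  qed
  then have "card (dyadic k ` E) \<le> card (dyadic k ` S \<union> (\<lambda>c. dyadic k c + 1 / 2 ^ k) ` S)"
    using S by (intro card_mono) auto
  also have "\<dots> \<le> card (dyadic k ` S) + card ((\<lambda>c. dyadic k c + 1 / 2 ^ k) ` S)"
    by (rule card_Un_le)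
  also have "\<dots> \<le> card S + card S" using S by (intro add_mono card_image_le)
  finally show ?thesis using S by simp
qed

lemma covering_number_le:
  assumes "upper_minkowski_dim E < ereal s"
  shows "\<forall>\<^sub>F k in sequentially. real (covering_number E (1 / 2 ^ k)) \<le> 2 powr (real k * s)"
proof -
  have "\<forall>\<^sub>F \<delta> in at_right 0. ereal (ln (real (covering_number E \<delta>)) / ln (1 / \<delta>)) < ereal s"
    using assms unfolding upper_minkowski_dim_def by (rule Limsup_lessD)
  moreover have "filterlim (\<lambda>k. 1 / 2 ^ k :: real) (at_right 0) sequentially"
  proof (rule tendsto_imp_filterlim_at_right)
    have "(\<lambda>k. (1 / 2 :: real) ^ k) \<longlonglongrightarrow> 0" by (rule LIMSEQ_power_zero) simp
    then show "(\<lambda>k. 1 / 2 ^ k :: real) \<longlonglongrightarrow> 0" by (simp add: power_one_over)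
  qed simp
  ultimately have "\<forall>\<^sub>F k in sequentially. ereal (ln (real (covering_number E (1 / 2 ^ k))) / ln (1 / (1 / 2 ^ k))) < ereal s"
    by (rule eventually_compose_filterlim)
  \<comment> \<open>At \<open>k = 0\<close> the denominator \<open>ln (1 / \<delta>)\<close> is 0,
    so this scale is discarded.\<close>
  then show ?thesis
    using eventually_gt_at_top[of 0]
  proof eventually_elim
    case (elim k)
    show ?case
    \<comment> \<open>\<open>exp\<close> undoes \<open>ln\<close> only for a positive covering
      number; the value 0 satisfies the bound trivially.\<close>
    proof (cases "covering_number E (1 / 2 ^ k) = 0")
      case False
      have "ln (real (covering_number E (1 / 2 ^ k))) / (real k * ln 2) < s"
        using elim by (simp add: ln_realpow)
      then have "ln (real (covering_number E (1 / 2 ^ k))) < s * (real k * ln 2)"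
        using elim by (subst (asm) pos_divide_less_eq) auto
      then have "exp (ln (real (covering_number E (1 / 2 ^ k)))) \<le> exp (s * (real k * ln 2))"
        by simp
      then show ?thesis using False by (simp add: powr_def mult_ac)
    qed simp
  qed
qed

text \<open>For \<open>s = 1\<close> the grid itself has few enough points; for \<open>s\<close>
  above the dimension the covering numbers give the count at fine scales, and the constant absorbs
  the coarse ones.\<close>

lemma card_dyadic_bound:
  assumes E: "E \<subseteq> {1..2}" and s: "upper_minkowski_dim E < ereal s \<or> s = 1"
  shows "\<exists>K. \<forall>k. real (card (dyadic k ` E)) \<le> K * 2 powr (real k * s)"
proof (cases "s = 1")
  case True
  have "real (card (dyadic k ` E)) \<le> 2 * 2 powr (real k * s)" for k
  proof -
    have "real (card (dyadic k ` E)) \<le> real (2 ^ k + 1)"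
      using finite_dyadic_image(2)[OF E, of k] of_nat_le_iff by blast
    also have "\<dots> \<le> 2 * 2 ^ k" using one_le_power[of "2::real" k] by simp
    finally show ?thesis using True by (simp add: powr_realpow)
  qed
  then show ?thesis by blast
next
  case False
  then obtain k0 where k0: "\<And>k. k \<ge> k0 \<Longrightarrow> real (covering_number E (1 / 2 ^ k)) \<le> 2 powr (real k * s)"
    using covering_number_le[of E s] s unfolding eventually_sequentially by blast
  \<comment> \<open>The 2 is the loss in passing from covers to grid points; the sum dominates the
    finitely many scales before \<open>k0\<close>.\<close>
  define K where "K = 2 + (\<Sum>k<k0. real (card (dyadic k ` E)) / 2 powr (real k * s))"
  have "real (card (dyadic k ` E)) \<le> K * 2 powr (real k * s)" for k
  proof (cases "k < k0")
    case True
    have "real (card (dyadic k ` E)) / 2 powr (real k * s) \<le> (\<Sum>k<k0. real (card (dyadic k ` E)) / 2 powr (real k * s))"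
      using True by (intro member_le_sum) auto
    also have "\<dots> \<le> K" unfolding K_def by simp
    finally show ?thesis by (simp add: pos_divide_le_eq)
  next
    case False
    have "real (card (dyadic k ` E)) \<le> 2 * real (covering_number E (1 / 2 ^ k))"
      using card_dyadic_le_covering_number[OF E, of k] by linarith
    also have "\<dots> \<le> 2 * 2 powr (real k * s)" using k0[of k] False by simp
    also have "\<dots> \<le> K * 2 powr (real k * s)"
      unfolding K_def by (intro mult_right_mono) (auto intro!: sum_nonneg)
    finally show ?thesis .
  qed
  then show ?thesis by blast
qed

section \<open>Maximal functions of families of multipliers\<close>

lemma measurable_bilin [measurable]:
  fixes u v :: "'a::euclidean_space \<Rightarrow> complex"
  assumes [measurable]: "u \<in> borel_measurable borel" "v \<in> borel_measurable borel"
    "\<mu> \<in> borel_measurable borel"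
  shows "bilin u v \<mu> \<in> borel_measurable borel"
proof -
  have [measurable]: "\<mu> \<in> borel_measurable (borel \<Otimes>\<^sub>M borel)" by (simp add: borel_prod)
  show ?thesis unfolding bilin_def lborel_prod[symmetric] by measurable
qed

lemma bilin_diff:
  fixes u v :: "'a::euclidean_space \<Rightarrow> complex"
  assumes [measurable]: "u \<in> borel_measurable borel" "v \<in> borel_measurable borel"
    "\<mu> \<in> borel_measurable borel" "\<nu> \<in> borel_measurable borel"
    and \<mu>: "integrable lborel (\<lambda>(\<xi>, \<eta>). u \<xi> * v \<eta> * \<mu> (\<xi>, \<eta>))"
    and \<nu>: "integrable lborel (\<lambda>(\<xi>, \<eta>). u \<xi> * v \<eta> * \<nu> (\<xi>, \<eta>))"
  shows "bilin u v (\<lambda>z. \<mu> z - \<nu> z) x = bilin u v \<mu> x - bilin u v \<nu> x"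
proof -
  have "bilin u v \<mu> x - bilin u v \<nu> x
     = (LINT z|lborel. (\<lambda>(\<xi>, \<eta>). u \<xi> * v \<eta> * \<mu> (\<xi>, \<eta>) * cis (2 * pi * (x \<bullet> (\<xi> + \<eta>)))) z
         - (\<lambda>(\<xi>, \<eta>). u \<xi> * v \<eta> * \<nu> (\<xi>, \<eta>) * cis (2 * pi * (x \<bullet> (\<xi> + \<eta>)))) z)"
    unfolding bilin_def
    by (rule Bochner_Integration.integral_diff[symmetric]) (use \<mu> \<nu> in \<open>simp_all add: bilin_integrable_iff\<close>)
  also have "\<dots> = bilin u v (\<lambda>z. \<mu> z - \<nu> z) x"
    unfolding bilin_def by (intro Bochner_Integration.integral_cong) (auto simp: algebra_simps)
  finally show ?thesis by simp
qed

definition rho :: "'a::euclidean_space \<times> 'a \<Rightarrow> real" where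
  "rho z = 1 + norm (fst z) + norm (snd z)"

lemma rho_ge_1: "1 \<le> rho z"
  by (simp add: rho_def)

lemma measurable_rho [measurable]: "rho \<in> borel_measurable borel"
  unfolding rho_def by (intro borel_measurable_continuous_onI continuous_intros)

text \<open>The input of the chaining argument. \<open>M t\<close> will be the dilated multiplier
  times the symbols of the translation differences, \<open>u\<close> and \<open>v\<close> the
  transforms of the data, and \<open>a\<close> the decay exponent that remains once those symbols
  are absorbed. The extra \<open>rho z\<close> in the Lipschitz bound comes from differentiating in
  the dilation parameter.\<close>

locale multiplier_family =
  fixes E :: "real set" and M :: "real \<Rightarrow> 'a::euclidean_space \<times> 'a \<Rightarrow> complex"
    and a s K B :: real and u v :: "'a \<Rightarrow> complex"
  assumes E: "E \<subseteq> {1..2}"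
    and M_meas [measurable]: "\<And>t. M t \<in> borel_measurable borel"
    and size: "\<And>t z. t \<in> {1..2} \<Longrightarrow> norm (M t z) \<le> B * rho z powr - a"
    and lip: "\<And>t t' z. t \<in> {1..2} \<Longrightarrow> t' \<in> {1..2} \<Longrightarrow>
      norm (M t z - M t' z) \<le> B * \<bar>t - t'\<bar> * rho z * rho z powr - a"
    and card: "\<And>k. real (card (dyadic k ` E)) \<le> K * 2 powr (real k * s)"
    and s: "s \<le> 1" and a: "0 \<le> a"
    and u_meas [measurable]: "u \<in> borel_measurable borel"
    and v_meas [measurable]: "v \<in> borel_measurable borel"
    and u_fin: "(\<integral>\<^sup>+ x. ennreal ((norm (u x))\<^sup>2) \<partial>lborel) < \<infinity>"
    and v_fin: "(\<integral>\<^sup>+ x. ennreal ((norm (v x))\<^sup>2) \<partial>lborel) < \<infinity>"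
begin

abbreviation "L2u \<equiv> (\<integral>\<^sup>+ x. ennreal ((norm (u x))\<^sup>2) \<partial>lborel)"
abbreviation "L2v \<equiv> (\<integral>\<^sup>+ x. ennreal ((norm (v x))\<^sup>2) \<partial>lborel)"

lemma B_nonneg: "0 \<le> B"
proof -
  have "0 \<le> norm (M 1 0)" by simp
  also have "\<dots> \<le> B * rho (0 :: 'a \<times> 'a) powr - a" by (rule size) simp
  finally show ?thesis by (simp add: rho_def)
qed

lemma K_nonneg: "0 \<le> K"
proof -
  have "0 \<le> real (card (dyadic 0 ` E))" by simp
  also have "\<dots> \<le> K" using card[of 0] by simp
  finally show ?thesis .
qed

text \<open>Half-open ranges make a shell the difference of two truncations, and the cutoff does not
  involve \<open>t\<close>, so differences in \<open>t\<close> live on the same shell.\<close>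

definition shell :: "nat \<Rightarrow> real \<Rightarrow> 'a \<times> 'a \<Rightarrow> complex" where
  "shell j t z = (if 2 ^ j \<le> rho z \<and> rho z < 2 ^ Suc j then M t z else 0)"

lemma measurable_shell [measurable]: "shell j t \<in> borel_measurable borel"
  unfolding shell_def by measurable

lemma shell_support: "shell j t (\<xi>, \<eta>) \<noteq> 0 \<Longrightarrow> norm \<xi> \<le> 2 ^ Suc j \<and> norm \<eta> \<le> 2 ^ Suc j"
  by (auto simp: shell_def rho_def split: if_splits intro: order_trans[OF _ less_imp_le])
     (use norm_ge_zero[of \<xi>] norm_ge_zero[of \<eta>] in linarith)+

lemma rho_powr_le:
  assumes "2 ^ j \<le> rho z"
  shows "rho z powr - a \<le> 2 powr - (real j * a)"
proof -
  have "rho z powr - a \<le> (2 ^ j) powr - a"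
    using assms a by (intro powr_mono2') auto
  also have "\<dots> = 2 powr - (real j * a)"
    by (simp add: powr_realpow[symmetric] powr_powr)
  finally show ?thesis .
qed

lemma norm_shell_le: "t \<in> {1..2} \<Longrightarrow> norm (shell j t z) \<le> B * 2 powr - (real j * a)"
  using order_trans[OF size mult_left_mono[OF rho_powr_le B_nonneg]] B_nonneg
  by (auto simp: shell_def)

lemma norm_shell_diff_le:
  assumes t: "t \<in> {1..2}" "t' \<in> {1..2}"
  shows "norm (shell j t z - shell j t' z) \<le> 2 * B * \<bar>t - t'\<bar> * 2 ^ j * 2 powr - (real j * a)"
proof (cases "2 ^ j \<le> rho z \<and> rho z < 2 ^ Suc j")
  case True
  then have "norm (shell j t z - shell j t' z) \<le> B * \<bar>t - t'\<bar> * rho z * rho z powr - a"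
    using lip[OF t] by (simp add: shell_def)
  also have "\<dots> \<le> B * \<bar>t - t'\<bar> * (2 * 2 ^ j) * 2 powr - (real j * a)"
    using True B_nonneg rho_ge_1[of z] by (intro mult_mono rho_powr_le) auto
  finally show ?thesis by (simp add: mult_ac)
next
  case False
  then have "shell j t z = 0" "shell j t' z = 0" by (auto simp: shell_def)
  then show ?thesis using B_nonneg by simp
qed

text \<open>Links of the chain in the dilation parameter: \<open>dyadic (j + i) t\<close> telescopes to \<open>t\<close>, and each
  link depends on its finer endpoint \<open>q\<close> only, so that for \<open>t \<in> E\<close> there are few of them at every scale.\<close>

fun inc :: "nat \<Rightarrow> nat \<Rightarrow> real \<Rightarrow> 'a \<times> 'a \<Rightarrow> complex" where
  "inc j 0 q = shell j q"
| "inc j (Suc i) q = (\<lambda>z. shell j q z - shell j (dyadic (j + i) q) z)"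

lemma measurable_inc [measurable]: "inc j i q \<in> borel_measurable borel"
  by (cases i) auto

lemma inc_support: "inc j i q (\<xi>, \<eta>) \<noteq> 0 \<Longrightarrow> norm \<eta> \<le> 2 ^ Suc j"
proof (cases i)
  case (Suc n)
  moreover assume "inc j i q (\<xi>, \<eta>) \<noteq> 0"
  ultimately have "shell j q (\<xi>, \<eta>) \<noteq> 0 \<or> shell j (dyadic (j + n) q) (\<xi>, \<eta>) \<noteq> 0" by auto
  then show ?thesis using shell_support by blast
qed (use shell_support in auto)

text \<open>The Lipschitz bound contributes \<open>2 ^ j\<close>, which the mesh
  \<open>1 / 2 ^ (j + n)\<close> of the coarse endpoint cancels; this is the reason for starting the
  chain at scale \<open>j\<close>. The index shift from \<open>n\<close> to \<open>i = Suc n\<close>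
  turns the factor 2 into 4.\<close>

lemma norm_inc_le:
  assumes "q \<in> {1..2}"
  shows "norm (inc j i q z) \<le> 4 * B * 2 powr - (real j * a) / 2 ^ i"
proof (cases i)
  case 0
  have "B * 2 powr - (real j * a) \<le> 4 * B * 2 powr - (real j * a)"
    using B_nonneg by simp
  with norm_shell_le[OF assms, of j z] 0 show ?thesis by simp
next
  case (Suc n)
  have "norm (inc j i q z) \<le> 2 * B * \<bar>q - dyadic (j + n) q\<bar> * 2 ^ j * 2 powr - (real j * a)"
    unfolding Suc using norm_shell_diff_le[OF assms dyadic_mem[OF assms]] by simp
  also have "\<dots> \<le> 2 * B * (1 / 2 ^ (j + n)) * 2 ^ j * 2 powr - (real j * a)"
    using dyadic_bounds(1)[of "j + n" q] dyadic_bounds(2)[of q "j + n"] B_nonneg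
    by (intro mult_right_mono mult_left_mono) (auto simp: abs_le_iff)
  also have "\<dots> = 4 * B * 2 powr - (real j * a) / 2 ^ i"
    unfolding Suc by (simp add: power_add field_simps)
  finally show ?thesis .
qed

lemma nn_integral_inc_le:
  assumes "q \<in> {1..2}"
  shows "(\<integral>\<^sup>+ x. ennreal ((norm (bilin u v (inc j i q) x))\<^sup>2) \<partial>lborel)
    \<le> ennreal (unit_ball_vol (real DIM('a)) * (2 ^ Suc j) ^ DIM('a) * (4 * B * 2 powr - (real j * a) / 2 ^ i)\<^sup>2) * L2u * L2v"
  by (rule nn_integral_bilin_le) (use norm_inc_le[OF assms] inc_support in auto)

text \<open>A measurable majorant for the squared maximal function of one shell: the supremum over E
  has become countably many sums over finite sets. The leading 3 is
  \<open>\<theta> / (\<theta> - 1)\<close> for the weight \<theta> = 3/2, which lies strictly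
  between 1 and the guaranteed decay rate 2 of the squared links after counting.\<close>

definition level :: "nat \<Rightarrow> 'a \<Rightarrow> ennreal" where
  "level j x = 3 * (\<Sum>i. ennreal ((3 / 2) ^ i) *
     (\<Sum>q\<in>dyadic (j + i) ` E. ennreal ((norm (bilin u v (inc j i q) x))\<^sup>2)))"

lemma measurable_level [measurable]: "level j \<in> borel_measurable borel"
  unfolding level_def by measurable

lemma shell_integrable:
  assumes "t \<in> {1..2}"
  shows "integrable lborel (\<lambda>(\<xi>, \<eta>). u \<xi> * v \<eta> * shell j t (\<xi>, \<eta>))"
  using u_meas v_meas measurable_shell u_fin v_fin norm_shell_le[OF assms] shell_support
  by (rule bilin_integrable)

lemma bilin_shell_tendsto:
  assumes t: "t \<in> {1..2}"
  shows "(\<lambda>n. bilin u v (shell j (dyadic (j + n) t)) x) \<longlonglongrightarrow> bilin u v (shell j t) x"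
  unfolding bilin_def
proof (rule integral_dominated_convergence)
  \<comment> \<open>The constant majorant on the shell, written as a complex symbol so that
    \<open>bilin_integrable\<close> applies to it.\<close>
  let ?c = "\<lambda>z. if 2 ^ j \<le> rho z \<and> rho z < 2 ^ Suc j then complex_of_real (B * 2 powr - (real j * a)) else 0"
  have [measurable]: "u \<in> borel_measurable lborel" "v \<in> borel_measurable lborel" by simp_all
  have "integrable lborel (\<lambda>(\<xi>, \<eta>). u \<xi> * v \<eta> * ?c (\<xi>, \<eta>))"
  proof (rule bilin_integrable[OF _ _ _ u_fin v_fin])
    show "norm (?c z) \<le> B * 2 powr - (real j * a)" for z
      using B_nonneg by (auto simp: norm_mult)
    show "norm \<xi> \<le> 2 ^ Suc j \<and> norm \<eta> \<le> 2 ^ Suc j" if "?c (\<xi>, \<eta>) \<noteq> 0" for \<xi> \<eta>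
    proof -
      from that have "1 + norm \<xi> + norm \<eta> < 2 ^ Suc j"
        by (simp add: rho_def split: if_splits)
      then show ?thesis using norm_ge_zero[of \<xi>] norm_ge_zero[of \<eta>] by linarith
    qed
  qed measurable
  then show "integrable lborel (\<lambda>z. norm ((\<lambda>(\<xi>, \<eta>). u \<xi> * v \<eta> * ?c (\<xi>, \<eta>)) z))"
    by (rule integrable_norm)
  have mm: "(\<lambda>(\<xi>, \<eta>). u \<xi> * v \<eta> * shell j t (\<xi>, \<eta>) * cis (2 * pi * (x \<bullet> (\<xi> + \<eta>)))) \<in> borel_measurable (borel \<Otimes>\<^sub>M borel)" for t
  proof -
    have [measurable]: "shell j t \<in> borel_measurable (borel \<Otimes>\<^sub>M borel)" by (simp add: borel_prod)
    show ?thesis by measurable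
  qed
  then show "(\<lambda>(\<xi>, \<eta>). u \<xi> * v \<eta> * shell j t (\<xi>, \<eta>) * cis (2 * pi * (x \<bullet> (\<xi> + \<eta>)))) \<in> borel_measurable lborel"
   "\<And>n. (\<lambda>(\<xi>, \<eta>). u \<xi> * v \<eta> * shell j (dyadic (j + n) t) (\<xi>, \<eta>) * cis (2 * pi * (x \<bullet> (\<xi> + \<eta>)))) \<in> borel_measurable lborel"
    by (simp_all add: borel_prod)
  have "(\<lambda>n. shell j (dyadic (j + n) t) z) \<longlonglongrightarrow> shell j t z" for z
  proof (rule LIM_zero_cancel, rule Lim_null_comparison)
    show "\<forall>\<^sub>F n in sequentially. norm (shell j (dyadic (j + n) t) z - shell j t z) \<le> 2 * B * \<bar>dyadic (j + n) t - t\<bar> * 2 ^ j * 2 powr - (real j * a)"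
      using norm_shell_diff_le[OF dyadic_mem[OF t] t] by simp
    have "(\<lambda>n. 2 * B * \<bar>dyadic (j + n) t - t\<bar> * 2 ^ j * 2 powr - (real j * a)) \<longlonglongrightarrow> 2 * B * \<bar>t - t\<bar> * 2 ^ j * 2 powr - (real j * a)"
      by (intro tendsto_intros dyadic_tendsto)
    then show "(\<lambda>n. 2 * B * \<bar>dyadic (j + n) t - t\<bar> * 2 ^ j * 2 powr - (real j * a)) \<longlonglongrightarrow> 0" by simp
  qed
  then show "AE z in lborel. (\<lambda>n. (\<lambda>(\<xi>, \<eta>). u \<xi> * v \<eta> * shell j (dyadic (j + n) t) (\<xi>, \<eta>) * cis (2 * pi * (x \<bullet> (\<xi> + \<eta>)))) z)
      \<longlonglongrightarrow> (\<lambda>(\<xi>, \<eta>). u \<xi> * v \<eta> * shell j t (\<xi>, \<eta>) * cis (2 * pi * (x \<bullet> (\<xi> + \<eta>)))) z"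
    by (intro AE_I2) (auto split: prod.split intro!: tendsto_intros)
  show "AE z in lborel. norm ((\<lambda>(\<xi>, \<eta>). u \<xi> * v \<eta> * shell j (dyadic (j + n) t) (\<xi>, \<eta>) * cis (2 * pi * (x \<bullet> (\<xi> + \<eta>)))) z)
     \<le> norm ((\<lambda>(\<xi>, \<eta>). u \<xi> * v \<eta> * ?c (\<xi>, \<eta>)) z)" for n
  proof (intro AE_I2)
    fix z :: "'a \<times> 'a"
    obtain \<xi> \<eta> where z: "z = (\<xi>, \<eta>)" by (cases z)
    have "norm (shell j (dyadic (j + n) t) z) \<le> norm (?c z)"
      using norm_shell_le[OF dyadic_mem[OF t], of j "j + n" z] B_nonneg
      by (auto simp: shell_def norm_mult)
    then show "norm ((\<lambda>(\<xi>, \<eta>). u \<xi> * v \<eta> * shell j (dyadic (j + n) t) (\<xi>, \<eta>) * cis (2 * pi * (x \<bullet> (\<xi> + \<eta>)))) z)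
     \<le> norm ((\<lambda>(\<xi>, \<eta>). u \<xi> * v \<eta> * ?c (\<xi>, \<eta>)) z)"
      unfolding z prod.case norm_mult norm_cis mult_1_right by (intro mult_left_mono) auto
  qed
qed

lemma bilin_shell_le_level:
  assumes tE: "t \<in> E"
  shows "ennreal ((norm (bilin u v (shell j t) x))\<^sup>2) \<le> level j x"
proof -
  have t: "t \<in> {1..2}" using E tE by auto
  define d where "d i = bilin u v (inc j i (dyadic (j + i) t)) x" for i
  \<comment> \<open>Nestedness of the grids identifies the coarse endpoint inside \<open>inc\<close>
    with the previous approximation of \<open>t\<close>, and the sum telescopes.\<close>
  have dSuc: "d (Suc i) = bilin u v (shell j (dyadic (j + Suc i) t)) x - bilin u v (shell j (dyadic (j + i) t)) x" for i
  proof -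
    have "d (Suc i) = bilin u v (\<lambda>z. shell j (dyadic (j + Suc i) t) z - shell j (dyadic (j + i) t) z) x"
      unfolding d_def using dyadic_dyadic_Suc[of "j + i" t] by simp
    also have "\<dots> = bilin u v (shell j (dyadic (j + Suc i) t)) x - bilin u v (shell j (dyadic (j + i) t)) x"
      by (rule bilin_diff) (use shell_integrable[OF dyadic_mem[OF t]] in auto)
    finally show ?thesis .
  qed
  \<comment> \<open>The term \<open>d 0\<close> is the whole shell at the coarsest point, so
    \<open>Suc n\<close> terms reach the approximation of order \<open>j + n\<close>.\<close>
  have "(\<Sum>i<Suc n. d i) = bilin u v (shell j (dyadic (j + n) t)) x" for n
    by (induction n) (simp_all add: dSuc, simp add: d_def)
  then have "(\<lambda>n. \<Sum>i<Suc n. d i) \<longlonglongrightarrow> bilin u v (shell j t) x"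
    using bilin_shell_tendsto[OF t] by simp
  then have "(\<lambda>n. \<Sum>i<n. d i) \<longlonglongrightarrow> bilin u v (shell j t) x"
    by (rule LIMSEQ_imp_Suc)
  then have "ennreal ((norm (bilin u v (shell j t) x))\<^sup>2) \<le> ennreal ((3 / 2) / (3 / 2 - 1)) * (\<Sum>i. ennreal ((3 / 2) ^ i * (norm (d i))\<^sup>2))"
    by (intro weighted_Cauchy_Schwarz) simp
  also have "\<dots> \<le> level j x"
    unfolding level_def
  proof (intro mult_mono suminf_le)
    fix i
    have "ennreal ((norm (d i))\<^sup>2) \<le> (\<Sum>q\<in>dyadic (j + i) ` E. ennreal ((norm (bilin u v (inc j i q) x))\<^sup>2))"
      unfolding d_def using tE finite_dyadic_image(1)[OF E]
      by (intro member_le_sum[of _ _ "\<lambda>q. ennreal ((norm (bilin u v (inc j i q) x))\<^sup>2)"]) auto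
    then show "ennreal ((3 / 2) ^ i * (norm (d i))\<^sup>2) \<le> ennreal ((3 / 2) ^ i) * (\<Sum>q\<in>dyadic (j + i) ` E. ennreal ((norm (bilin u v (inc j i q) x))\<^sup>2))"
      by (simp add: ennreal_mult mult_left_mono)
  qed auto
  finally show ?thesis .
qed

text \<open>In the exponent, d comes from the volume of a ball of radius \<open>2 ^ Suc j\<close>,
  \<open>s\<close> from the number of points at scale \<open>j\<close>, and \<open>- 2 * a\<close>
  from the squared size. The constant 192 is 3 from \<open>level\<close>, times 4 from the geometric
  series of ratio 3/4, times 16 from the squared link bound.\<close>

lemma nn_integral_level_le:
  "(\<integral>\<^sup>+ x. level j x \<partial>lborel)
    \<le> ennreal (192 * K * unit_ball_vol (real DIM('a)) * 2 ^ DIM('a) * B\<^sup>2 * 2 powr (real j * (real DIM('a) + s - 2 * a))) * L2u * L2v"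
proof -
  define W where "W = unit_ball_vol (real DIM('a)) * (2 ^ Suc j) ^ DIM('a)"
  define p where "p = 2 powr - (real j * a)"
  define c where "c = 16 * K * W * B\<^sup>2 * p\<^sup>2 * 2 powr (real j * s)"
  have W0: "0 \<le> W" unfolding W_def by simp
  have c0: "0 \<le> c" unfolding c_def using K_nonneg W0 by simp
  have summand: "ennreal ((3 / 2) ^ i) * (\<Sum>q\<in>dyadic (j + i) ` E. \<integral>\<^sup>+ x. ennreal ((norm (bilin u v (inc j i q) x))\<^sup>2) \<partial>lborel)
     \<le> ennreal (c * (3 / 4) ^ i) * (L2u * L2v)" for i
  proof -
    define w where "w = W * (4 * B * p / 2 ^ i)\<^sup>2"
    have w0: "0 \<le> w" using W0 by (simp add: w_def)
    have "(\<Sum>q\<in>dyadic (j + i) ` E. \<integral>\<^sup>+ x. ennreal ((norm (bilin u v (inc j i q) x))\<^sup>2) \<partial>lborel)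
      \<le> (\<Sum>q\<in>dyadic (j + i) ` E. ennreal w * L2u * L2v)"
      unfolding w_def W_def p_def using E dyadic_mem by (intro sum_mono nn_integral_inc_le) blast
    also have "\<dots> = ennreal (real (card (dyadic (j + i) ` E)) * w) * (L2u * L2v)"
      using w0 by (simp add: ennreal_mult ennreal_of_nat_eq_real_of_nat mult_ac)
    finally have "ennreal ((3 / 2) ^ i) * (\<Sum>q\<in>dyadic (j + i) ` E. \<integral>\<^sup>+ x. ennreal ((norm (bilin u v (inc j i q) x))\<^sup>2) \<partial>lborel)
      \<le> ennreal ((3 / 2) ^ i) * (ennreal (real (card (dyadic (j + i) ` E)) * w) * (L2u * L2v))"
      by (intro mult_left_mono) auto
    also have "\<dots> = ennreal ((3 / 2) ^ i * (real (card (dyadic (j + i) ` E)) * w)) * (L2u * L2v)"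
      using w0 by (simp add: ennreal_mult mult.assoc)
    also have "\<dots> \<le> ennreal (c * (3 / 4) ^ i) * (L2u * L2v)"
    proof (intro mult_right_mono ennreal_leI)
      have "real (card (dyadic (j + i) ` E)) \<le> K * 2 powr (real (j + i) * s)" by (rule card)
      also have "\<dots> = K * (2 powr (real j * s) * 2 powr (real i * s))"
        by (simp add: powr_add[symmetric] distrib_right)
      \<comment> \<open>Here \<open>s \<le> 1\<close> enters: refining by \<open>i\<close> scales
        multiplies the count bound by at most \<open>2 ^ i\<close>, against the gain
        \<open>4 ^ i\<close> of the squared links.\<close>
      also have "\<dots> \<le> K * (2 powr (real j * s) * 2 powr (real i))"
        using K_nonneg s by (intro mult_left_mono powr_mono) (auto simp: mult_left_le)
      also have "\<dots> = K * (2 powr (real j * s) * 2 ^ i)" by (simp add: powr_realpow)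
      finally have "(3 / 2) ^ i * (real (card (dyadic (j + i) ` E)) * w) \<le> (3 / 2) ^ i * ((K * (2 powr (real j * s) * 2 ^ i)) * w)"
        using w0 by (intro mult_left_mono mult_right_mono) auto
      also have "\<dots> = c * ((3 / 2) ^ i * 2 ^ i / (2 ^ i)\<^sup>2)"
        unfolding w_def c_def by (simp add: power2_eq_square)
      also have "(3 / 2) ^ i * 2 ^ i / (2 ^ i)\<^sup>2 = (3 / 4 :: real) ^ i"
        by (simp add: power_mult_distrib[symmetric] power_divide[symmetric] power2_eq_square)
      finally show "(3 / 2) ^ i * (real (card (dyadic (j + i) ` E)) * w) \<le> c * (3 / 4) ^ i" .
    qed auto
    finally show ?thesis .
  qed
  have "(\<integral>\<^sup>+ x. level j x \<partial>lborel) = 3 * (\<Sum>i. ennreal ((3 / 2) ^ i) * (\<Sum>q\<in>dyadic (j + i) ` E. \<integral>\<^sup>+ x. ennreal ((norm (bilin u v (inc j i q) x))\<^sup>2) \<partial>lborel))"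
    unfolding level_def by (simp add: nn_integral_cmult nn_integral_suminf nn_integral_sum del: sum_ennreal)
  also have "\<dots> \<le> 3 * (\<Sum>i. ennreal (c * (3 / 4) ^ i) * (L2u * L2v))"
    by (intro mult_left_mono suminf_le summand) auto
  also have "\<dots> = 3 * ((\<Sum>i. ennreal (c * (3 / 4) ^ i)) * (L2u * L2v))"
    by (simp add: ennreal_suminf_multc)
  also have "(\<Sum>i. ennreal (c * (3 / 4) ^ i)) = ennreal (c * 4)"
    using c0 geometric_sums[of "3 / 4 :: real", THEN sums_mult, of c]
    by (intro suminf_ennreal_eq) auto
  also have "3 * (ennreal (c * 4) * (L2u * L2v)) = ennreal (12 * c) * L2u * L2v"
  proof -
    have "3 * (ennreal (c * 4) * (L2u * L2v)) = ennreal 3 * (ennreal (c * 4) * (L2u * L2v))"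
      by simp
    also have "\<dots> = ennreal (3 * (c * 4)) * (L2u * L2v)"
      using c0 by (simp only: ennreal_mult mult_nonneg_nonneg mult.assoc zero_le_numeral)
    also have "3 * (c * 4) = 12 * c" by simp
    finally show ?thesis by (simp only: mult.assoc)
  qed
  also have "12 * c = 192 * K * unit_ball_vol (real DIM('a)) * 2 ^ DIM('a) * B\<^sup>2 * 2 powr (real j * (real DIM('a) + s - 2 * a))"
  proof -
    have "(2 ^ Suc j) ^ DIM('a) * p\<^sup>2 * 2 powr (real j * s) = 2 ^ DIM('a) * (2 powr (real j * real DIM('a)) * 2 powr (- (real j * a) * 2) * 2 powr (real j * s))"
    proof -
      have "(2 ^ Suc j) ^ DIM('a) = 2 ^ DIM('a) * (2 :: real) ^ (j * DIM('a))"
        by (simp add: power_mult_distrib power_mult)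
      also have "(2 :: real) ^ (j * DIM('a)) = 2 powr (real j * real DIM('a))"
        by (simp add: powr_realpow[symmetric])
      finally have 1: "(2 ^ Suc j) ^ DIM('a) = 2 ^ DIM('a) * 2 powr (real j * real DIM('a))" .
      have "p\<^sup>2 = 2 powr (- (real j * a) + - (real j * a))"
        unfolding p_def power2_eq_square by (rule powr_add[symmetric])
      also have "- (real j * a) + - (real j * a) = - (real j * a) * 2" by simp
      finally show ?thesis unfolding 1 by (simp only: mult.assoc)
    qed
    also have "\<dots> = 2 ^ DIM('a) * 2 powr (real j * (real DIM('a) + s - 2 * a))"
      by (simp add: powr_add[symmetric] algebra_simps)
    finally have "(2 ^ Suc j) ^ DIM('a) * p\<^sup>2 * 2 powr (real j * s) = 2 ^ DIM('a) * 2 powr (real j * (real DIM('a) + s - 2 * a))" .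
    moreover have "12 * c = 192 * K * unit_ball_vol (real DIM('a)) * B\<^sup>2 * ((2 ^ Suc j) ^ DIM('a) * p\<^sup>2 * 2 powr (real j * s))"
      unfolding c_def W_def by (simp add: mult_ac)
    ultimately have "12 * c = 192 * K * unit_ball_vol (real DIM('a)) * B\<^sup>2 * (2 ^ DIM('a) * 2 powr (real j * (real DIM('a) + s - 2 * a)))"
      by (simp only:)
    then show ?thesis by (simp only: mult_ac)
  qed
  finally show ?thesis .
qed

section \<open>Summation over the shells\<close>

lemma sum_bilin_shell_tendsto:
  assumes t: "t \<in> {1..2}"
    and int: "integrable lborel (\<lambda>(\<xi>, \<eta>). u \<xi> * v \<eta> * M t (\<xi>, \<eta>))"
  shows "(\<lambda>n. \<Sum>j<n. bilin u v (shell j t) x) \<longlonglongrightarrow> bilin u v (M t) x"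
proof -
  \<comment> \<open>Partial sums of shells are truncations of the symbol, dominated by the full
    integrand.\<close>
  define trunc where "trunc n z = (if rho z < 2 ^ n then M t z else 0)" for n z
  have [measurable]: "trunc n \<in> borel_measurable borel" for n
    unfolding trunc_def by measurable
  have tmm: "(\<lambda>(\<xi>, \<eta>). u \<xi> * v \<eta> * trunc n (\<xi>, \<eta>)) \<in> borel_measurable lborel" for n
  proof -
    have [measurable]: "trunc n \<in> borel_measurable (borel \<Otimes>\<^sub>M borel)" by (simp add: borel_prod)
    have "(\<lambda>(\<xi>, \<eta>). u \<xi> * v \<eta> * trunc n (\<xi>, \<eta>)) \<in> borel_measurable (borel \<Otimes>\<^sub>M borel)" by measurable
    then show ?thesis by (simp add: borel_prod)
  qed
  have ti: "integrable lborel (\<lambda>(\<xi>, \<eta>). u \<xi> * v \<eta> * trunc n (\<xi>, \<eta>))" for n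
    by (rule Bochner_Integration.integrable_bound[OF int tmm])
      (auto simp: trunc_def norm_mult)
  have sh: "shell n t = (\<lambda>z. trunc (Suc n) z - trunc n z)" for n
  proof
    fix z :: "'a \<times> 'a"
    have "rho z < 2 ^ Suc n" if "rho z < 2 ^ n"
      using that by (rule order.strict_trans2) simp
    then show "shell n t z = trunc (Suc n) z - trunc n z"
      unfolding shell_def trunc_def by (cases "rho z < 2 ^ n") auto
  qed
  have sum: "(\<Sum>j<n. bilin u v (shell j t) x) = bilin u v (trunc n) x" for n
  proof (induction n)
    case 0
    \<comment> \<open>Since \<open>rho\<close> is at least 1, no frequencies lie below the shell of
      index 0.\<close>
    have "\<not> rho z < 1" for z :: "'a \<times> 'a" using rho_ge_1[of z] by linarith
    then have "trunc 0 = (\<lambda>z. 0)" by (simp add: trunc_def fun_eq_iff)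
    then show ?case by (simp add: bilin_def case_prod_beta')
  next
    case (Suc n)
    have "bilin u v (shell n t) x = bilin u v (trunc (Suc n)) x - bilin u v (trunc n) x"
      unfolding sh by (rule bilin_diff) (use ti in auto)
    with Suc show ?case by simp
  qed
  have "(\<lambda>n. bilin u v (trunc n) x) \<longlonglongrightarrow> bilin u v (M t) x"
    unfolding bilin_def
  proof (rule integral_dominated_convergence)
    show "integrable lborel (\<lambda>z. norm ((\<lambda>(\<xi>, \<eta>). u \<xi> * v \<eta> * M t (\<xi>, \<eta>)) z))"
      using int by (rule integrable_norm)
    show "(\<lambda>(\<xi>, \<eta>). u \<xi> * v \<eta> * M t (\<xi>, \<eta>) * cis (2 * pi * (x \<bullet> (\<xi> + \<eta>)))) \<in> borel_measurable lborel"
      using int by (intro borel_measurable_integrable) (simp add: bilin_integrable_iff)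
    show "(\<lambda>(\<xi>, \<eta>). u \<xi> * v \<eta> * trunc n (\<xi>, \<eta>) * cis (2 * pi * (x \<bullet> (\<xi> + \<eta>)))) \<in> borel_measurable lborel" for n
      using ti by (intro borel_measurable_integrable) (simp add: bilin_integrable_iff)
    have "(\<lambda>n. trunc n z) \<longlonglongrightarrow> M t z" for z
    proof (rule tendsto_eventually)
      obtain N where N: "rho z < 2 ^ N" using real_arch_pow[of 2 "rho z"] by auto
      show "\<forall>\<^sub>F n in sequentially. trunc n z = M t z"
        using eventually_ge_at_top[of N]
      proof eventually_elim
        case (elim n)
        have "(2::real) ^ N \<le> 2 ^ n" using elim by (intro power_increasing) auto
        with N have "rho z < 2 ^ n" by linarith
        then show ?case by (simp add: trunc_def)
      qed
    qed
    then show "AE z in lborel. (\<lambda>n. (\<lambda>(\<xi>, \<eta>). u \<xi> * v \<eta> * trunc n (\<xi>, \<eta>) * cis (2 * pi * (x \<bullet> (\<xi> + \<eta>)))) z)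
      \<longlonglongrightarrow> (\<lambda>(\<xi>, \<eta>). u \<xi> * v \<eta> * M t (\<xi>, \<eta>) * cis (2 * pi * (x \<bullet> (\<xi> + \<eta>)))) z"
      by (intro AE_I2) (auto split: prod.split intro!: tendsto_intros)
    show "AE z in lborel. norm ((\<lambda>(\<xi>, \<eta>). u \<xi> * v \<eta> * trunc n (\<xi>, \<eta>) * cis (2 * pi * (x \<bullet> (\<xi> + \<eta>)))) z)
       \<le> norm ((\<lambda>(\<xi>, \<eta>). u \<xi> * v \<eta> * M t (\<xi>, \<eta>)) z)" for n
      by (intro AE_I2) (auto simp: norm_mult trunc_def)
  qed
  then show ?thesis by (simp add: sum)
qed

text \<open>The integral of \<open>level j\<close> decays like \<open>\<theta>\<close> to the power
  -2j. The weighted Cauchy-Schwarz inequality spends half of this, and the other half sums as a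
  geometric series; each half contributes one factor
  \<open>\<theta> / (\<theta> - 1)\<close>.\<close>

theorem nn_integral_maximal_le:
  assumes \<sigma>: "real DIM('a) + s < 2 * a"
  defines "\<theta> \<equiv> 2 powr ((2 * a - real DIM('a) - s) / 2)"
  shows "(\<integral>\<^sup>+ x. (SUP t\<in>E. ennreal (norm (bilin u v (M t) x)))\<^sup>2 \<partial>lborel)
    \<le> ennreal ((\<theta> / (\<theta> - 1))\<^sup>2 * (192 * K * unit_ball_vol (real DIM('a)) * 2 ^ DIM('a) * B\<^sup>2)) * L2u * L2v"
proof -
  have \<theta>: "\<theta> > 1" unfolding \<theta>_def using \<sigma> by simp
  define c where "c = 192 * K * unit_ball_vol (real DIM('a)) * 2 ^ DIM('a) * B\<^sup>2"
  have c0: "0 \<le> c" unfolding c_def using K_nonneg by simp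
  define R where "R x = ennreal (\<theta> / (\<theta> - 1)) * (\<Sum>j. ennreal (\<theta> ^ j) * level j x)" for x
  have pointwise: "ennreal ((norm (bilin u v (M t) x))\<^sup>2) \<le> R x" if "t \<in> E" for t x
  proof (cases "integrable lborel (\<lambda>(\<xi>, \<eta>). u \<xi> * v \<eta> * M t (\<xi>, \<eta>))")
    \<comment> \<open>A Bochner integral that does not converge is \<open>0\<close>, so no integrability of \<open>u\<close> and \<open>v\<close> is needed.\<close>
    case False
    then have "bilin u v (M t) x = 0"
      unfolding bilin_def by (intro not_integrable_integral_eq) (simp add: bilin_integrable_iff)
    then show ?thesis by simp
  next
    case True
    have t: "t \<in> {1..2}" using that E by auto
    have "ennreal ((norm (bilin u v (M t) x))\<^sup>2) \<le> ennreal (\<theta> / (\<theta> - 1)) * (\<Sum>j. ennreal (\<theta> ^ j * (norm (bilin u v (shell j t) x))\<^sup>2))"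
      by (rule weighted_Cauchy_Schwarz[OF \<theta> sum_bilin_shell_tendsto[OF t True]])
    also have "\<dots> \<le> R x"
      unfolding R_def using \<theta>
      by (intro mult_left_mono suminf_le) (auto simp: ennreal_mult intro!: mult_left_mono bilin_shell_le_level that)
    finally show ?thesis .
  qed
  \<comment> \<open>The square is moved past the supremum by bounding each value by a real square
    root, possible once \<open>R x\<close> is finite.\<close>
  have sup: "(SUP t\<in>E. ennreal (norm (bilin u v (M t) x)))\<^sup>2 \<le> R x" for x
  proof (cases "R x = \<infinity>")
    case False
    then obtain r where r: "R x = ennreal r" "0 \<le> r" by (cases "R x") auto
    have "norm (bilin u v (M t) x) \<le> sqrt r" if "t \<in> E" for t
      using pointwise[OF that, of x] r by (intro real_le_rsqrt) simp
    then have "(SUP t\<in>E. ennreal (norm (bilin u v (M t) x))) \<le> ennreal (sqrt r)"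
      by (intro SUP_least ennreal_leI)
    then have "(SUP t\<in>E. ennreal (norm (bilin u v (M t) x)))\<^sup>2 \<le> (ennreal (sqrt r))\<^sup>2"
      by (intro power_mono) auto
    also have "\<dots> = R x" using r by (simp add: ennreal_power)
    finally show ?thesis .
  qed simp
  have lev: "ennreal (\<theta> ^ j) * (\<integral>\<^sup>+ x. level j x \<partial>lborel) \<le> ennreal (c * (1 / \<theta>) ^ j) * (L2u * L2v)" for j
  proof -
    have "ennreal (\<theta> ^ j) * (\<integral>\<^sup>+ x. level j x \<partial>lborel)
      \<le> ennreal (\<theta> ^ j) * (ennreal (c * 2 powr (real j * (real DIM('a) + s - 2 * a))) * L2u * L2v)"
      unfolding c_def by (intro mult_left_mono nn_integral_level_le) simp
    also have "\<dots> = ennreal (\<theta> ^ j * (c * 2 powr (real j * (real DIM('a) + s - 2 * a)))) * (L2u * L2v)"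
      using \<theta> c0 by (simp add: ennreal_mult mult.assoc)
    also have "2 powr (real j * (real DIM('a) + s - 2 * a)) = (1 / \<theta>) ^ j * (1 / \<theta>) ^ j"
    proof -
      have "1 / \<theta> = 2 powr ((real DIM('a) + s - 2 * a) / 2)"
      proof -
        have "real DIM('a) + s - 2 * a = - (2 * a - real DIM('a) - s)" by simp
        then show ?thesis unfolding \<theta>_def powr_minus_divide[symmetric] by (simp only: divide_minus_left)
      qed
      then have "(1 / \<theta>) ^ j = 2 powr (real j * ((real DIM('a) + s - 2 * a) / 2))"
        by (simp add: powr_realpow[symmetric] powr_powr mult.commute)
      then show ?thesis by (simp add: powr_add[symmetric])
    qed
    also have "\<theta> ^ j * (c * ((1 / \<theta>) ^ j * (1 / \<theta>) ^ j)) = c * (1 / \<theta>) ^ j"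
      using \<theta> by (simp add: power_divide)
    finally show ?thesis .
  qed
  have "(\<integral>\<^sup>+ x. (SUP t\<in>E. ennreal (norm (bilin u v (M t) x)))\<^sup>2 \<partial>lborel) \<le> (\<integral>\<^sup>+ x. R x \<partial>lborel)"
    by (intro nn_integral_mono sup)
  also have "\<dots> = ennreal (\<theta> / (\<theta> - 1)) * (\<Sum>j. ennreal (\<theta> ^ j) * (\<integral>\<^sup>+ x. level j x \<partial>lborel))"
    unfolding R_def by (simp add: nn_integral_cmult nn_integral_suminf)
  also have "\<dots> \<le> ennreal (\<theta> / (\<theta> - 1)) * (\<Sum>j. ennreal (c * (1 / \<theta>) ^ j) * (L2u * L2v))"
    by (intro mult_left_mono suminf_le lev) auto
  also have "\<dots> = ennreal (\<theta> / (\<theta> - 1)) * ((\<Sum>j. ennreal (c * (1 / \<theta>) ^ j)) * (L2u * L2v))"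
    by (simp add: ennreal_suminf_multc)
  also have "(\<Sum>j. ennreal (c * (1 / \<theta>) ^ j)) = ennreal (c * (\<theta> / (\<theta> - 1)))"
  proof (rule suminf_ennreal_eq)
    have "(\<lambda>j. c * (1 / \<theta>) ^ j) sums (c * (1 / (1 - 1 / \<theta>)))"
      using \<theta> by (intro sums_mult geometric_sums) auto
    moreover have "1 / (1 - 1 / \<theta>) = \<theta> / (\<theta> - 1)" using \<theta> by (simp add: field_simps)
    ultimately show "(\<lambda>j. c * (1 / \<theta>) ^ j) sums (c * (\<theta> / (\<theta> - 1)))" by simp
  qed (use \<theta> c0 in auto)
  also have "ennreal (\<theta> / (\<theta> - 1)) * (ennreal (c * (\<theta> / (\<theta> - 1))) * (L2u * L2v)) = ennreal ((\<theta> / (\<theta> - 1))\<^sup>2 * c) * L2u * L2v"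
  proof -
    define q where "q = \<theta> / (\<theta> - 1)"
    have "0 \<le> q" using \<theta> by (simp add: q_def)
    then have "ennreal q * (ennreal (c * q) * (L2u * L2v)) = ennreal (q * (c * q)) * (L2u * L2v)"
      using c0 by (simp only: ennreal_mult mult_nonneg_nonneg mult.assoc)
    also have "q * (c * q) = q\<^sup>2 * c" by (simp add: power2_eq_square)
    finally show ?thesis by (simp only: q_def mult.assoc)
  qed
  finally show ?thesis unfolding c_def .
qed

end

section \<open>Admissible multipliers\<close>

lemma rho_mono:
  fixes z w :: "'a::euclidean_space \<times> 'a"
  assumes "\<And>b. b \<in> Basis \<Longrightarrow> \<bar>z \<bullet> b\<bar> \<le> \<bar>w \<bullet> b\<bar>"
  shows "rho z \<le> rho w"
proof -
  have "norm (fst z) \<le> norm (fst w)"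
    using assms[of "(_, 0)"] by (intro norm_le_componentwise) (auto simp: inner_prod_def Basis_prod_def)
  moreover have "norm (snd z) \<le> norm (snd w)"
    using assms[of "(0, _)"] by (intro norm_le_componentwise) (auto simp: inner_prod_def Basis_prod_def)
  ultimately show ?thesis by (simp add: rho_def)
qed

text \<open>\<open>C_diff\<close> speaks of derivatives at parameter 0 only; recentring at
  \<open>x + r *\<^sub>R b\<close> yields them along the whole coordinate line.\<close>

lemma C_diff_1D:
  fixes m :: "'a::euclidean_space \<Rightarrow> complex"
  assumes "C_diff 1 m"
  shows "continuous_on UNIV m"
    and "b \<in> Basis \<Longrightarrow> ((\<lambda>t. m (x + t *\<^sub>R b)) has_vector_derivative partial_deriv b m (x + r *\<^sub>R b)) (at r within S)"
proof -
  show "continuous_on UNIV m"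
    using assms unfolding C_diff_def multi_indices_def
    by (auto dest!: conjunct2 spec[of _ "[]"])
  assume b: "b \<in> Basis"
  have "(\<lambda>t. m ((x + r *\<^sub>R b) + t *\<^sub>R b)) differentiable (at 0)"
    using assms b unfolding C_diff_def multi_indices_def
    by (auto dest!: conjunct1 spec[of _ b] spec[of _ "[]"])
  then have "((\<lambda>t. m ((x + r *\<^sub>R b) + t *\<^sub>R b)) has_vector_derivative partial_deriv b m (x + r *\<^sub>R b)) (at 0)"
    unfolding partial_deriv_def by (simp add: vector_derivative_works)
  then have "((\<lambda>t. m ((x + r *\<^sub>R b) + t *\<^sub>R b)) has_vector_derivative partial_deriv b m (x + r *\<^sub>R b)) (at ((\<lambda>t. t - r) r))"
    by simp
  moreover have "((\<lambda>t. t - r) has_vector_derivative 1) (at r)"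
    by (auto intro!: derivative_eq_intros simp: has_real_derivative_iff_has_vector_derivative[symmetric])
  ultimately have "(((\<lambda>t. m ((x + r *\<^sub>R b) + t *\<^sub>R b)) \<circ> (\<lambda>t. t - r)) has_vector_derivative 1 *\<^sub>R partial_deriv b m (x + r *\<^sub>R b)) (at r)"
    by (intro vector_diff_chain_at)
  then have "((\<lambda>t. m (x + t *\<^sub>R b)) has_vector_derivative partial_deriv b m (x + r *\<^sub>R b)) (at r)"
    by (simp add: o_def algebra_simps)
  then show "((\<lambda>t. m (x + t *\<^sub>R b)) has_vector_derivative partial_deriv b m (x + r *\<^sub>R b)) (at r within S)"
    by (rule has_vector_derivative_at_within)
qed

text \<open>Moving from \<open>s z\<close> to \<open>t z\<close> one coordinate at a time keeps every coordinate at least as large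
  as that of \<open>z\<close>, so the decay of the partial derivatives at \<open>z\<close> applies along the whole path.\<close>

lemma dilate_diff_le:
  fixes m :: "'a::euclidean_space \<times> 'a \<Rightarrow> complex"
  assumes m: "C_diff 1 m" and "0 \<le> a" and C: "0 \<le> C"
    and bound: "\<And>b z. b \<in> Basis \<Longrightarrow> norm (partial_deriv b m z) \<le> C * rho z powr - a"
    and s: "s \<in> {1..2}" and t: "t \<in> {1..2}"
  shows "norm (m (t *\<^sub>R z) - m (s *\<^sub>R z)) \<le> 2 * real DIM('a) * C * \<bar>t - s\<bar> * rho z * rho z powr - a"
proof -
  \<comment> \<open>The coordinates in \<open>A\<close> already carry the factor \<open>t\<close>,
    the others still \<open>s\<close>. Coordinate moves suit the hypothesis, which supplies partial
    derivatives.\<close>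
  define y where "y A = s *\<^sub>R z + (t - s) *\<^sub>R (\<Sum>b\<in>A. (z \<bullet> b) *\<^sub>R b)" for A
  have y_coord: "y A \<bullet> c = (if c \<in> A then t else s) * (z \<bullet> c)"
    if "c \<in> Basis" "A \<subseteq> Basis" for A c
  proof -
    have "finite A" using that finite_subset finite_Basis by blast
    then have "(\<Sum>b\<in>A. (z \<bullet> b) *\<^sub>R b) \<bullet> c = (\<Sum>b\<in>A. if b = c then z \<bullet> c else 0)"
      unfolding inner_sum_left using that by (intro sum.cong) (auto simp: inner_Basis subset_iff)
    then show ?thesis using \<open>finite A\<close> by (simp add: y_def inner_add_left algebra_simps)
  qed
  have path: "norm (m (y A) - m (s *\<^sub>R z)) \<le> (\<Sum>b\<in>A. \<bar>t - s\<bar> * \<bar>z \<bullet> b\<bar> * (C * rho z powr - a))"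
    if "finite A" "A \<subseteq> Basis" for A
    using that
  proof (induction A rule: finite_induct)
    case empty
    then show ?case by (simp add: y_def)
  next
    case (insert b A)
    then have A: "A \<subseteq> Basis" and b: "b \<in> Basis" by auto
    define l where "l = (t - s) * (z \<bullet> b)"
    have yi: "y (insert b A) = y A + l *\<^sub>R b"
      unfolding y_def l_def using insert.hyps by (simp add: algebra_simps)
    have "norm (m (y A + l *\<^sub>R b) - m (y A + 0 *\<^sub>R b)) \<le> (C * rho z powr - a) * norm (l - 0)"
    proof (rule differentiable_bound[of "closed_segment 0 l"])
      fix r assume r: "r \<in> closed_segment 0 l"
      show "((\<lambda>r. m (y A + r *\<^sub>R b)) has_derivative (\<lambda>h. h *\<^sub>R partial_deriv b m (y A + r *\<^sub>R b))) (at r within closed_segment 0 l)"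
        using C_diff_1D(2)[OF m b] by (simp add: has_vector_derivative_def)
      obtain k where k: "0 \<le> k" "k \<le> 1" "r = k * l"
        using r by (auto simp: in_segment)
      have "rho z \<le> rho (y A + r *\<^sub>R b)"
      proof (rule rho_mono)
        fix c :: "'a \<times> 'a" assume c: "c \<in> Basis"
        \<comment> \<open>The factor of the moving coordinate is a convex combination of
          \<open>s\<close> and \<open>t\<close>, so it stays at least 1.\<close>
        have conv: "1 \<le> s + k * (t - s)"
        proof -
          have "1 = (1 - k) * 1 + k * 1" by simp
          also have "\<dots> \<le> (1 - k) * s + k * t"
            using k s t by (intro add_mono mult_left_mono) auto
          finally show ?thesis by (simp add: algebra_simps)
        qed
        have "(y A + r *\<^sub>R b) \<bullet> c = (if c = b then s + k * (t - s) else if c \<in> A then t else s) * (z \<bullet> c)"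
          using c b insert.hyps A
          by (auto simp: inner_add_left y_coord inner_Basis k l_def algebra_simps)
        moreover have "1 \<le> (if c = b then s + k * (t - s) else if c \<in> A then t else s)"
          using conv s t by auto
        ultimately show "\<bar>z \<bullet> c\<bar> \<le> \<bar>(y A + r *\<^sub>R b) \<bullet> c\<bar>"
          by (auto simp: abs_mult mult_le_cancel_right1)
      qed
      then have "rho (y A + r *\<^sub>R b) powr - a \<le> rho z powr - a"
        using rho_ge_1[of z] \<open>0 \<le> a\<close> by (intro powr_mono2') auto
      then have "norm (partial_deriv b m (y A + r *\<^sub>R b)) \<le> C * rho z powr - a"
        using bound[OF b, of "y A + r *\<^sub>R b"] C by (meson mult_left_mono order_trans)
      then show "onorm (\<lambda>h. h *\<^sub>R partial_deriv b m (y A + r *\<^sub>R b)) \<le> C * rho z powr - a"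
        using C by (intro onorm_bound) (auto simp: mult.commute[of _ "\<bar>_\<bar>"] intro!: mult_left_mono)
    qed auto
    then have "norm (m (y (insert b A)) - m (y A)) \<le> \<bar>t - s\<bar> * \<bar>z \<bullet> b\<bar> * (C * rho z powr - a)"
      by (simp add: yi l_def abs_mult mult_ac)
    with insert.IH[OF A] show ?case
      using insert.hyps norm_triangle_le[of "m (y (insert b A)) - m (y A)" "m (y A) - m (s *\<^sub>R z)"] by simp
  qed
  have "y Basis = t *\<^sub>R z"
    unfolding y_def euclidean_representation by (simp add: algebra_simps)
  then have "norm (m (t *\<^sub>R z) - m (s *\<^sub>R z)) \<le> (\<Sum>b\<in>Basis. \<bar>t - s\<bar> * \<bar>z \<bullet> b\<bar> * (C * rho z powr - a))"
    using path[OF finite_Basis order_refl] by simp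
  also have "\<dots> \<le> (\<Sum>b\<in>(Basis :: ('a \<times> 'a) set). \<bar>t - s\<bar> * rho z * (C * rho z powr - a))"
  proof (intro sum_mono mult_right_mono mult_left_mono)
    fix b :: "'a \<times> 'a" assume "b \<in> Basis"
    then have "\<bar>z \<bullet> b\<bar> \<le> norm z" by (rule Basis_le_norm)
    also have "\<dots> \<le> norm (fst z) + norm (snd z)"
      by (metis norm_Pair_le prod.collapse)
    finally show "\<bar>z \<bullet> b\<bar> \<le> rho z" by (simp add: rho_def)
  qed (use C in auto)
  \<comment> \<open>The factor \<open>2 * real DIM('a)\<close> counts the coordinates of a
    pair.\<close>
  also have "\<dots> = 2 * real DIM('a) * C * \<bar>t - s\<bar> * rho z * rho z powr - a"
    by simp
  finally show ?thesis .
qed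

lemma admissible_dilate_bounds:
  fixes m :: "'a::euclidean_space \<times> 'a \<Rightarrow> complex"
  assumes "admissible 1 a m"
  shows "\<exists>C\<ge>0. (\<forall>t\<in>{1..2}. \<forall>z. norm (m (t *\<^sub>R z)) \<le> C * rho z powr - a) \<and>
    (\<forall>s\<in>{1..2}. \<forall>t\<in>{1..2}. \<forall>z.
      norm (m (t *\<^sub>R z) - m (s *\<^sub>R z)) \<le> C * \<bar>t - s\<bar> * rho z * rho z powr - a)"
proof -
  have m: "C_diff 1 m" and a: "0 \<le> a"
    using assms unfolding admissible_def by (auto intro: order_trans[OF _ less_imp_le])
  have ex: "\<exists>C. \<forall>z. norm (iter_deriv \<alpha> m z) \<le> C * rho z powr - a" if "\<alpha> \<in> multi_indices 1" for \<alpha>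
    using assms that unfolding admissible_def rho_def by (metis prod.collapse)
  have "[] \<in> multi_indices 1" by (simp add: multi_indices_def)
  from ex[OF this] obtain C0 where C0: "\<And>z. norm (m z) \<le> C0 * rho z powr - a" by auto
  have "\<exists>C. \<forall>z. norm (partial_deriv b m z) \<le> C * rho z powr - a" if "b \<in> Basis" for b
    using ex[of "[b]"] that by (simp add: multi_indices_def)
  then obtain Cb where Cb: "\<And>b z. b \<in> Basis \<Longrightarrow> norm (partial_deriv b m z) \<le> Cb b * rho z powr - a"
    by metis
  define C1 where "C1 = (\<Sum>b\<in>(Basis :: ('a \<times> 'a) set). \<bar>Cb b\<bar>)"
  have C1: "0 \<le> C1" unfolding C1_def by (intro sum_nonneg) auto
  have C1b: "norm (partial_deriv b m z) \<le> C1 * rho z powr - a" if "b \<in> Basis" for b z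
  proof -
    have "Cb b \<le> \<bar>Cb b\<bar>" by simp
    also have "\<dots> \<le> C1" unfolding C1_def using that by (intro member_le_sum) auto
    finally show ?thesis using Cb[OF that, of z] by (meson mult_right_mono order_trans powr_ge_zero)
  qed
  define C where "C = \<bar>C0\<bar> + 2 * real DIM('a) * C1"
  show ?thesis
  proof (intro exI[of _ C] conjI ballI allI)
    show "0 \<le> C" unfolding C_def using C1 by simp
    show "norm (m (t *\<^sub>R z)) \<le> C * rho z powr - a" if t: "t \<in> {1..2}" for t z
    proof -
      have "rho z \<le> rho (t *\<^sub>R z)"
        using t by (intro rho_mono) (auto simp: abs_mult mult_le_cancel_right1)
      then have "rho (t *\<^sub>R z) powr - a \<le> rho z powr - a"
        using a rho_ge_1[of z] by (intro powr_mono2') auto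
      moreover have "C0 \<le> C" unfolding C_def using C1 by (simp add: add_increasing2)
      ultimately have "C0 * rho (t *\<^sub>R z) powr - a \<le> C * rho z powr - a"
        using \<open>0 \<le> C\<close> by (meson mult_mono powr_ge_zero)
      with C0[of "t *\<^sub>R z"] show ?thesis by linarith
    qed
    show "norm (m (t *\<^sub>R z) - m (s *\<^sub>R z)) \<le> C * \<bar>t - s\<bar> * rho z * rho z powr - a"
      if "s \<in> {1..2}" "t \<in> {1..2}" for s t z
    proof -
      have "norm (m (t *\<^sub>R z) - m (s *\<^sub>R z)) \<le> 2 * real DIM('a) * C1 * \<bar>t - s\<bar> * rho z * rho z powr - a"
        by (rule dilate_diff_le[OF m a C1 C1b that])
      also have "\<dots> \<le> C * \<bar>t - s\<bar> * rho z * rho z powr - a"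
        unfolding C_def using rho_ge_1[of z] by (intro mult_right_mono) auto
      finally show ?thesis .
    qed
  qed
qed

text \<open>Interpolation between two bounds: the chord is at most the arc, good for small angles,
  and at most 2, good for large ones.\<close>

lemma norm_one_minus_cis_le:
  assumes "0 < \<gamma>" "\<gamma> \<le> 1"
  shows "norm (1 - cis \<theta>) \<le> 2 * \<bar>\<theta>\<bar> powr \<gamma>"
proof (cases "\<bar>\<theta>\<bar> \<le> 1")
  case True
  have "norm (1 - cis \<theta>) = 2 * \<bar>sin (\<theta> / 2)\<bar>"
    using dist_exp_i_1[of \<theta>] by (simp add: cis_conv_exp dist_norm norm_minus_commute)
  also have "\<dots> \<le> 2 * \<bar>\<theta> / 2\<bar>"
    by (intro mult_left_mono abs_sin_x_le_abs_x) simp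
  also have "\<dots> = \<bar>\<theta>\<bar> powr 1" by simp
  also have "\<dots> \<le> \<bar>\<theta>\<bar> powr \<gamma>" using assms True by (intro powr_mono') auto
  also have "\<dots> \<le> 2 * \<bar>\<theta>\<bar> powr \<gamma>" by simp
  finally show ?thesis .
next
  case False
  have "norm (1 - cis \<theta>) \<le> 1 + 1" using norm_triangle_ineq4[of 1 "cis \<theta>"] by simp
  also have "\<dots> \<le> 2 * \<bar>\<theta>\<bar> powr \<gamma>" using assms False ge_one_powr_ge_zero[of "\<bar>\<theta>\<bar>" \<gamma>] by simp
  finally show ?thesis .
qed

lemma norm_fourier_symbol_le:
  fixes h \<xi> :: "'a::euclidean_space"
  assumes \<gamma>: "0 < \<gamma>" "\<gamma> \<le> 1" and r: "norm \<xi> \<le> r"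
  shows "norm (1 - cis (- 2 * pi * (h \<bullet> \<xi>))) \<le> 2 * (2 * pi) powr \<gamma> * norm h powr \<gamma> * r powr \<gamma>"
proof -
  have "\<bar>h \<bullet> \<xi>\<bar> \<le> norm h * r"
    using Cauchy_Schwarz_ineq2[of h \<xi>] r by (meson mult_left_mono norm_ge_zero order_trans)
  then have "\<bar>- 2 * pi * (h \<bullet> \<xi>)\<bar> \<le> 2 * pi * (norm h * r)"
    by (simp add: abs_mult)
  then have "\<bar>- 2 * pi * (h \<bullet> \<xi>)\<bar> powr \<gamma> \<le> (2 * pi * (norm h * r)) powr \<gamma>"
    using \<gamma> by (intro powr_mono2) auto
  also have "\<dots> = (2 * pi) powr \<gamma> * norm h powr \<gamma> * r powr \<gamma>"
    using order_trans[OF norm_ge_zero r] by (simp add: powr_mult)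
  finally show ?thesis
    using norm_one_minus_cis_le[OF \<gamma>, of "- 2 * pi * (h \<bullet> \<xi>)"] by simp
qed

lemma fourier_diff_translate:
  fixes f :: "'a::euclidean_space \<Rightarrow> complex"
  assumes f: "integrable lborel f"
  shows "fourier (\<lambda>x. f x - translate h f x) \<xi> = (1 - cis (- 2 * pi * (h \<bullet> \<xi>))) * fourier f \<xi>"
proof -
  have [measurable]: "f \<in> borel_measurable borel"
    using f by (auto dest: borel_measurable_integrable)
  have 1: "integrable lborel (\<lambda>x. f x * cis (- 2 * pi * (x \<bullet> \<xi>)))"
    by (rule Bochner_Integration.integrable_bound[OF f]) (auto simp: norm_mult)
  have "integrable lborel (\<lambda>x. f (- h + x))"
    using f nn_integral_shift[of "\<lambda>x. ennreal (norm (f x))" "- h"] by (simp add: integrable_iff_bounded)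
  then have 2: "integrable lborel (\<lambda>x. f (x - h) * cis (- 2 * pi * (x \<bullet> \<xi>)))"
    by (rule Bochner_Integration.integrable_bound) (auto simp: norm_mult)
  have "fourier (\<lambda>x. f x - translate h f x) \<xi>
    = (LINT x|lborel. f x * cis (- 2 * pi * (x \<bullet> \<xi>)) - f (x - h) * cis (- 2 * pi * (x \<bullet> \<xi>)))"
    unfolding fourier_def translate_def by (simp add: left_diff_distrib)
  also have "\<dots> = fourier f \<xi> - (LINT x|lborel. f (x - h) * cis (- 2 * pi * (x \<bullet> \<xi>)))"
    unfolding fourier_def by (rule Bochner_Integration.integral_diff[OF 1 2])
  also have "(LINT x|lborel. f (x - h) * cis (- 2 * pi * (x \<bullet> \<xi>)))
     = (LINT x|lborel. f (h + x - h) * cis (- 2 * pi * ((h + x) \<bullet> \<xi>)))"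
    by (rule integral_shift[symmetric]) measurable
  also have "\<dots> = (LINT x|lborel. cis (- 2 * pi * (h \<bullet> \<xi>)) * (f x * cis (- 2 * pi * (x \<bullet> \<xi>))))"
    by (intro Bochner_Integration.integral_cong) (auto simp: cis_mult inner_add_left algebra_simps)
  also have "\<dots> = cis (- 2 * pi * (h \<bullet> \<xi>)) * fourier f \<xi>"
    unfolding fourier_def by simp
  finally show ?thesis by (simp add: left_diff_distrib)
qed

section \<open>Test functions and the bound for weighted multipliers\<close>

lemma
  fixes f :: "'a::euclidean_space \<Rightarrow> complex"
  assumes f: "test_function f"
  shows test_function_integrable: "integrable lborel f"
    and test_function_L2: "(\<integral>\<^sup>+ x. ennreal ((norm (f x))\<^sup>2) \<partial>lborel) < \<infinity>"
proof -
  let ?S = "closure {x. f x \<noteq> 0}"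
  have S: "compact ?S" using f by (simp add: test_function_def)
  have "C_diff 0 f" using f by (simp add: test_function_def)
  then have cont: "continuous_on UNIV f"
    unfolding C_diff_def multi_indices_def by auto
  then have contS: "continuous_on ?S f"
    by (rule continuous_on_subset) simp
  have zero: "f x = 0" if "x \<notin> ?S" for x
    using that closure_subset[of "{x. f x \<noteq> 0}"] by auto
  have "integrable lborel (\<lambda>x. indicator ?S x *\<^sub>R f x)"
    by (rule borel_integrable_compact[OF S contS])
  also have "(\<lambda>x. indicator ?S x *\<^sub>R f x) = f"
  proof
    show "indicator ?S x *\<^sub>R f x = f x" for x
      using zero[of x] by (cases "x \<in> ?S") simp_all
  qed
  finally show "integrable lborel f" .
  have "integrable lborel (\<lambda>x. indicator ?S x *\<^sub>R (norm (f x))\<^sup>2)"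
    by (intro borel_integrable_compact[OF S] continuous_on_power continuous_on_norm contS)
  also have "(\<lambda>x. indicator ?S x *\<^sub>R (norm (f x))\<^sup>2) = (\<lambda>x. (norm (f x))\<^sup>2)"
  proof
    show "indicator ?S x *\<^sub>R (norm (f x))\<^sup>2 = (norm (f x))\<^sup>2" for x
      using zero[of x] by (cases "x \<in> ?S") simp_all
  qed
  finally show "(\<integral>\<^sup>+ x. ennreal ((norm (f x))\<^sup>2) \<partial>lborel) < \<infinity>"
    by (simp add: integrable_iff_bounded)
qed

text \<open>Finite norms of the data keep \<open>L2_norm F\<close> out of its infinite branch, so
  that real square roots can be taken.\<close>

lemma L2_norm_le:
  fixes f g :: "'a::euclidean_space \<Rightarrow> complex"
  assumes le: "(\<integral>\<^sup>+ x. (F x)\<^sup>2 \<partial>lborel) \<le> ennreal (c\<^sup>2)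
      * (\<integral>\<^sup>+ x. ennreal ((norm (f x))\<^sup>2) \<partial>lborel) * (\<integral>\<^sup>+ x. ennreal ((norm (g x))\<^sup>2) \<partial>lborel)"
    and f: "(\<integral>\<^sup>+ x. ennreal ((norm (f x))\<^sup>2) \<partial>lborel) < \<infinity>"
    and g: "(\<integral>\<^sup>+ x. ennreal ((norm (g x))\<^sup>2) \<partial>lborel) < \<infinity>" and c: "0 \<le> c"
  shows "L2_norm F \<le> ennreal c * L2_norm (\<lambda>x. ennreal (norm (f x))) * L2_norm (\<lambda>x. ennreal (norm (g x)))"
proof -
  obtain p where p: "(\<integral>\<^sup>+ x. ennreal ((norm (f x))\<^sup>2) \<partial>lborel) = ennreal p" "0 \<le> p"
    using f by (cases "\<integral>\<^sup>+ x. ennreal ((norm (f x))\<^sup>2) \<partial>lborel") auto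
  obtain q where q: "(\<integral>\<^sup>+ x. ennreal ((norm (g x))\<^sup>2) \<partial>lborel) = ennreal q" "0 \<le> q"
    using g by (cases "\<integral>\<^sup>+ x. ennreal ((norm (g x))\<^sup>2) \<partial>lborel") auto
  have le': "(\<integral>\<^sup>+ x. (F x)\<^sup>2 \<partial>lborel) \<le> ennreal (c\<^sup>2 * p * q)"
    using le p q by (simp add: ennreal_mult)
  then obtain r where r: "(\<integral>\<^sup>+ x. (F x)\<^sup>2 \<partial>lborel) = ennreal r" "0 \<le> r"
    by (cases "\<integral>\<^sup>+ x. (F x)\<^sup>2 \<partial>lborel") (auto simp: top_unique)
  have "r \<le> c\<^sup>2 * p * q" using le' r p q by simp
  then have "sqrt r \<le> sqrt (c\<^sup>2 * p * q)" by (rule real_sqrt_le_mono)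
  also have "\<dots> = c * sqrt p * sqrt q" using c by (simp add: real_sqrt_mult)
  finally show ?thesis
    using p q r c by (simp add: L2_norm_def Let_def ennreal_power ennreal_mult[symmetric])
qed

text \<open>The weight \<open>w\<close> stands for any product of translation symbols. It is not
  dilated, so the Lipschitz bound in \<open>t\<close> concerns \<open>m\<close> alone, and its
  growth is paid for by the slack in the exponents. Linearity of the bound in \<open>b\<close> is
  what carries the powers of the shifts.\<close>

lemma admissible_maximal_bound:
  fixes m :: "'a::euclidean_space \<times> 'a \<Rightarrow> complex"
  assumes E: "E \<subseteq> {1..2}" and dim: "upper_minkowski_dim E = ereal \<beta>"
    and adm: "admissible 1 a m" and a\<beta>: "2 * a > real DIM('a) + \<beta>"
  shows "\<exists>\<gamma> C. 0 < \<gamma> \<and> \<gamma> \<le> 1 \<and> 0 \<le> C \<and> (\<forall>f g w b.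
      test_function f \<longrightarrow> test_function g \<longrightarrow> w \<in> borel_measurable borel \<longrightarrow> 0 \<le> b \<longrightarrow>
      (\<forall>z. norm (w z) \<le> b * rho z powr (2 * \<gamma>)) \<longrightarrow>
      L2_norm (\<lambda>x. SUP t\<in>E. ennreal (norm (bilin (fourier f) (fourier g) (\<lambda>z. w z * m (t *\<^sub>R z)) x)))
      \<le> ennreal (C * b) * L2_norm (\<lambda>x. ennreal (norm (f x))) * L2_norm (\<lambda>x. ennreal (norm (g x))))"
proof -
  define d where "d = real DIM('a)"
  have ad: "2 * a > d" using adm unfolding admissible_def d_def by linarith
  \<comment> \<open>If 2a exceeds d + 1, as it must when \<beta> = 1, the trivial exponent 1 serves.
    Otherwise \<beta> < 2a - d \<le> 1 leaves room for an exponent strictly between \<beta> and 2a -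
    d.\<close>
  obtain s where s: "s \<le> 1" "2 * a > d + s" "0 \<le> s" "upper_minkowski_dim E < ereal s \<or> s = 1"
  proof (cases "2 * a > d + 1")
    case True
    then show ?thesis by (intro that[of 1]) auto
  next
    case False
    have "\<beta> < 2 * a - d" using a\<beta> by (simp add: d_def)
    \<comment> \<open>The midpoint of \<beta> and 2a - d. Taking the maximum with 0 is harmless
      because 2a > d, and it later yields \<open>0 \<le> a'\<close>.\<close>
    define s0 where "s0 = max 0 ((\<beta> + (2 * a - d)) / 2)"
    have "\<beta> < (\<beta> + (2 * a - d)) / 2" "(\<beta> + (2 * a - d)) / 2 < 2 * a - d"
      using \<open>\<beta> < 2 * a - d\<close> by (auto simp: field_simps)
    then have "0 \<le> s0" "\<beta> < s0" "s0 < 2 * a - d"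
      unfolding s0_def less_max_iff_disj using ad by auto
    then show ?thesis using False that[of s0] by (simp add: dim)
  qed
  obtain K where K: "\<And>k. real (card (dyadic k ` E)) \<le> K * 2 powr (real k * s)"
    using card_dyadic_bound[OF E s(4)] by auto
  obtain C0 where C0: "0 \<le> C0" "\<forall>t\<in>{1..2}. \<forall>z. norm (m (t *\<^sub>R z)) \<le> C0 * rho z powr - a"
    "\<forall>s\<in>{1..2}. \<forall>t\<in>{1..2}. \<forall>z.
      norm (m (t *\<^sub>R z) - m (s *\<^sub>R z)) \<le> C0 * \<bar>t - s\<bar> * rho z * rho z powr - a"
    using admissible_dilate_bounds[OF adm] by (elim exE conjE)
  have "continuous_on UNIV m"
    using adm by (intro C_diff_1D) (simp add: admissible_def)
  then have m_meas [measurable]: "m \<in> borel_measurable borel"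
    by (rule borel_measurable_continuous_onI)
  \<comment> \<open>Lowering \<open>a\<close> by \<open>2 * \<gamma>\<close> costs
    \<open>4 * \<gamma>\<close> in \<open>2 * a\<close>; the 8 keeps this within half of the
    available gap. The cap at 1 is the range of exponents allowed in the symbol bound.\<close>
  define e where "e = (2 * a - d - s) / 8"
  define \<gamma> where "\<gamma> = min 1 e"
  define a' where "a' = a - 2 * \<gamma>"
  have "0 < e" using s(2) by (simp add: e_def)
  then have \<gamma>: "0 < \<gamma>" "\<gamma> \<le> 1" "\<gamma> \<le> e" by (simp_all add: \<gamma>_def)
  have a': "2 * a' > d + s" "0 \<le> a'"
  proof -
    have "8 * \<gamma> \<le> 2 * a - d - s" "0 \<le> d" using \<gamma>(3) by (simp_all add: d_def e_def)
    then show "2 * a' > d + s" "0 \<le> a'"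
      using \<gamma>(1) s(2,3) by (simp_all add: a'_def)
  qed
  define \<theta> where "\<theta> = 2 powr ((2 * a' - d - s) / 2)"
  define C where "C = sqrt ((\<theta> / (\<theta> - 1))\<^sup>2 * (192 * K * unit_ball_vol d * 2 ^ DIM('a))) * C0"
  have K0: "0 \<le> K" using K[of 0] order_trans[OF of_nat_0_le_iff] by simp
  have pos: "0 \<le> (\<theta> / (\<theta> - 1))\<^sup>2 * (192 * K * unit_ball_vol d * 2 ^ DIM('a))"
    using K0 by (simp add: d_def)
  show ?thesis
  proof (rule exI[of _ \<gamma>], rule exI[of _ C], intro conjI allI impI \<gamma>(1,2))
    show C: "0 \<le> C" unfolding C_def using pos C0 by simp
    fix f g :: "'a \<Rightarrow> complex" and w :: "'a \<times> 'a \<Rightarrow> complex" and b :: real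
    assume f: "test_function f" and g: "test_function g" and w[measurable]: "w \<in> borel_measurable borel"
      and b: "0 \<le> b" and wb: "\<forall>z. norm (w z) \<le> b * rho z powr (2 * \<gamma>)"
    note fi = test_function_integrable[OF f] and gi = test_function_integrable[OF g]
    have [measurable]: "f \<in> borel_measurable borel" "g \<in> borel_measurable borel"
      using fi gi by (auto dest: borel_measurable_integrable)
    note fF = nn_integral_fourier_le[OF fi] and gF = nn_integral_fourier_le[OF gi]
    have weight: "(b * rho z powr (2 * \<gamma>)) * (X * rho z powr - a) = b * X * rho z powr - a'" for z :: "'a \<times> 'a" and X
    proof -
      have "rho z powr (2 * \<gamma>) * rho z powr - a = rho z powr - a'"
        unfolding a'_def powr_add[symmetric] by simp
      moreover have "(b * rho z powr (2 * \<gamma>)) * (X * rho z powr - a) = b * X * (rho z powr (2 * \<gamma>) * rho z powr - a)"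
        by (simp only: mult_ac)
      ultimately show ?thesis by (simp only:)
    qed
    interpret multiplier_family E "\<lambda>t z. w z * m (t *\<^sub>R z)" a' s K "b * C0" "fourier f" "fourier g"
    proof
      show "(\<lambda>z. w z * m (t *\<^sub>R z)) \<in> borel_measurable borel" for t
        by measurable
      show "norm (w z * m (t *\<^sub>R z)) \<le> b * C0 * rho z powr - a'" if "t \<in> {1..2}" for t z
        unfolding norm_mult weight[symmetric]
        using wb[rule_format, of z] C0(2)[rule_format, OF that, of z] b by (intro mult_mono) auto
      show "norm (w z * m (t *\<^sub>R z) - w z * m (t' *\<^sub>R z)) \<le> b * C0 * \<bar>t - t'\<bar> * rho z * rho z powr - a'"
        if "t \<in> {1..2}" "t' \<in> {1..2}" for t t' z
      proof -
        have "norm (w z * m (t *\<^sub>R z) - w z * m (t' *\<^sub>R z)) = norm (w z) * norm (m (t *\<^sub>R z) - m (t' *\<^sub>R z))"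
          by (simp add: norm_mult[symmetric] right_diff_distrib)
        also have "\<dots> \<le> (b * rho z powr (2 * \<gamma>)) * ((C0 * \<bar>t - t'\<bar> * rho z) * rho z powr - a)"
          using wb[rule_format, of z] C0(3)[rule_format, OF that(2,1), of z] b by (intro mult_mono) auto
        also have "\<dots> = b * C0 * \<bar>t - t'\<bar> * rho z * rho z powr - a'"
          unfolding weight by (simp add: mult_ac)
        finally show ?thesis .
      qed
      show "(\<integral>\<^sup>+ x. ennreal ((norm (fourier f x))\<^sup>2) \<partial>lborel) < \<infinity>"
        using fF test_function_L2[OF f] by (rule order.strict_trans1)
      show "(\<integral>\<^sup>+ x. ennreal ((norm (fourier g x))\<^sup>2) \<partial>lborel) < \<infinity>"
        using gF test_function_L2[OF g] by (rule order.strict_trans1)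
    qed (use E K s a' in \<open>auto intro!: measurable_fourier\<close>)
    have "(\<integral>\<^sup>+ x. (SUP t\<in>E. ennreal (norm (bilin (fourier f) (fourier g) (\<lambda>z. w z * m (t *\<^sub>R z)) x)))\<^sup>2 \<partial>lborel)
      \<le> ennreal ((\<theta> / (\<theta> - 1))\<^sup>2 * (192 * K * unit_ball_vol d * 2 ^ DIM('a) * (b * C0)\<^sup>2))
        * (\<integral>\<^sup>+ x. ennreal ((norm (fourier f x))\<^sup>2) \<partial>lborel) * (\<integral>\<^sup>+ x. ennreal ((norm (fourier g x))\<^sup>2) \<partial>lborel)"
      using nn_integral_maximal_le a'(1) unfolding d_def \<theta>_def by blast
    also have "(\<theta> / (\<theta> - 1))\<^sup>2 * (192 * K * unit_ball_vol d * 2 ^ DIM('a) * (b * C0)\<^sup>2) = (C * b)\<^sup>2"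
      unfolding C_def power_mult_distrib real_sqrt_pow2[OF pos] by (simp only: mult_ac)
    also have "ennreal ((C * b)\<^sup>2) * (\<integral>\<^sup>+ x. ennreal ((norm (fourier f x))\<^sup>2) \<partial>lborel) * (\<integral>\<^sup>+ x. ennreal ((norm (fourier g x))\<^sup>2) \<partial>lborel)
      \<le> ennreal ((C * b)\<^sup>2) * (\<integral>\<^sup>+ x. ennreal ((norm (f x))\<^sup>2) \<partial>lborel) * (\<integral>\<^sup>+ x. ennreal ((norm (g x))\<^sup>2) \<partial>lborel)"
      by (intro mult_mono fF gF) auto
    finally show "L2_norm (\<lambda>x. SUP t\<in>E. ennreal (norm (bilin (fourier f) (fourier g) (\<lambda>z. w z * m (t *\<^sub>R z)) x)))
      \<le> ennreal (C * b) * L2_norm (\<lambda>x. ennreal (norm (f x))) * L2_norm (\<lambda>x. ennreal (norm (g x)))"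
      by (rule L2_norm_le) (use test_function_L2 f g C b in auto)
  qed
qed

text \<open>Only \<open>m\<close> is dilated, so the factors of the transforms pass into the symbol
  outside the dilation and are the same for every \<open>t\<close>.\<close>

lemma maximal_op_eq_bilin:
  assumes "\<And>\<xi>. fourier f' \<xi> = w1 \<xi> * fourier f \<xi>" and "\<And>\<eta>. fourier g' \<eta> = w2 \<eta> * fourier g \<eta>"
  shows "maximal_op m E f' g' = (\<lambda>x. SUP t\<in>E. ennreal (norm
    (bilin (fourier f) (fourier g) (\<lambda>z. w1 (fst z) * w2 (snd z) * m (t *\<^sub>R z)) x)))"
proof -
  have "fourier f' \<xi> * fourier g' \<eta> * dilate t m (\<xi>, \<eta>) * c
      = fourier f \<xi> * fourier g \<eta> * (w1 \<xi> * w2 \<eta> * m (t *\<^sub>R (\<xi>, \<eta>))) * c" for t \<xi> \<eta> c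
    unfolding assms dilate_def by (simp add: mult_ac)
  then show ?thesis
    unfolding maximal_op_def bilinear_op_def bilin_def by (simp only: fst_conv snd_conv)
qed

theorem corollary3p7:
  fixes E :: "real set" and \<beta> a :: real
    and m :: "(real ^ 'd) \<times> (real ^ 'd) \<Rightarrow> complex"
  assumes "E \<subseteq> {1..2}" and "E \<noteq> {}"
    and "upper_minkowski_dim E = ereal \<beta>"
    and "admissible 1 a m"
    and "2 * a > real CARD('d) + \<beta>"
  shows "(\<exists>\<gamma>>0. \<exists>C. \<forall>f g h. test_function f \<longrightarrow> test_function g \<longrightarrow> norm h < 1 \<longrightarrow>
            L2_norm (maximal_op m E (\<lambda>x. f x - translate h f x) g)
            + L2_norm (maximal_op m E f (\<lambda>x. g x - translate h g x))
            \<le> ennreal (C * norm h powr \<gamma>)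
                * L2_norm (\<lambda>x. ennreal (norm (f x))) * L2_norm (\<lambda>x. ennreal (norm (g x)))) \<and>
         (\<exists>\<gamma>1>0. \<exists>\<gamma>2>0. \<exists>C. \<forall>f g h1 h2. test_function f \<longrightarrow> test_function g \<longrightarrow>
            norm h1 < 1 \<longrightarrow> norm h2 < 1 \<longrightarrow>
            L2_norm (maximal_op m E (\<lambda>x. f x - translate h1 f x) (\<lambda>x. g x - translate h2 g x))
            \<le> ennreal (C * norm h1 powr \<gamma>1 * norm h2 powr \<gamma>2)
                * L2_norm (\<lambda>x. ennreal (norm (f x))) * L2_norm (\<lambda>x. ennreal (norm (g x))))"
proof -
  have a: "2 * a > real DIM(real ^ 'd) + \<beta>" using assms(5) by simp
  obtain \<gamma> C where \<gamma>: "0 < \<gamma>" "\<gamma> \<le> 1" and C: "0 \<le> C"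
    and bound: "\<forall>f g w b.
      test_function f \<longrightarrow> test_function g \<longrightarrow> w \<in> borel_measurable borel \<longrightarrow> 0 \<le> b \<longrightarrow>
      (\<forall>z. norm (w z) \<le> b * rho z powr (2 * \<gamma>)) \<longrightarrow>
      L2_norm (\<lambda>x. SUP t\<in>E. ennreal (norm (bilin (fourier f) (fourier g) (\<lambda>z. w z * m (t *\<^sub>R z)) x)))
      \<le> ennreal (C * b) * L2_norm (\<lambda>x. ennreal (norm (f x))) * L2_norm (\<lambda>x. ennreal (norm (g x)))"
    using admissible_maximal_bound[OF assms(1,3,4) a] by (elim exE conjE)
  define e where "e h \<xi> = 1 - cis (- 2 * pi * (h \<bullet> \<xi>))" for h \<xi> :: "real ^ 'd"
  define c where "c = 2 * (2 * pi) powr \<gamma>"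
  have c0: "0 \<le> c" unfolding c_def by simp
  have e1: "e h \<in> borel_measurable borel" for h
    unfolding e_def by measurable
  have e_meas: "(\<lambda>z :: (real ^ 'd) \<times> (real ^ 'd). e h (fst z)) \<in> borel_measurable borel"
    "(\<lambda>z :: (real ^ 'd) \<times> (real ^ 'd). e h (snd z)) \<in> borel_measurable borel" for h
  proof -
    have fst: "(fst :: (real ^ 'd) \<times> (real ^ 'd) \<Rightarrow> _) \<in> borel_measurable borel"
      and snd: "(snd :: (real ^ 'd) \<times> (real ^ 'd) \<Rightarrow> _) \<in> borel_measurable borel"
      by (intro borel_measurable_continuous_onI continuous_intros)+
    show "(\<lambda>z :: (real ^ 'd) \<times> (real ^ 'd). e h (fst z)) \<in> borel_measurable borel"
      by (rule measurable_compose[OF fst e1])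
    show "(\<lambda>z :: (real ^ 'd) \<times> (real ^ 'd). e h (snd z)) \<in> borel_measurable borel"
      by (rule measurable_compose[OF snd e1])
  qed
  have e_bound: "norm (e h (fst z)) \<le> c * norm h powr \<gamma> * rho z powr \<gamma>"
    "norm (e h (snd z)) \<le> c * norm h powr \<gamma> * rho z powr \<gamma>" for h z
    unfolding e_def c_def by (rule norm_fourier_symbol_le[OF \<gamma>], simp add: rho_def)+
  \<comment> \<open>A single difference grows only like \<open>rho z powr \<gamma>\<close>; since
    \<open>rho\<close> is at least 1, it also fits the weight bound made for two
    differences.\<close>
  have up: "c * norm h powr \<gamma> * rho z powr \<gamma> \<le> c * norm h powr \<gamma> * rho z powr (2 * \<gamma>)"
    for h :: "real ^ 'd" and z :: "(real ^ 'd) \<times> (real ^ 'd)"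
    using c0 \<gamma> rho_ge_1[of z] by (intro mult_left_mono powr_mono) auto
  have fe: "fourier (\<lambda>x. f x - translate h f x) \<xi> = e h \<xi> * fourier f \<xi>" if "test_function f" for f h \<xi>
    unfolding e_def by (rule fourier_diff_translate[OF test_function_integrable[OF that]])
  \<comment> \<open>The function that is not differenced enters \<open>maximal_op_eq_bilin\<close>
    with the constant symbol 1.\<close>
  have id: "fourier f \<xi> = 1 * fourier f \<xi>" for f and \<xi> :: "real ^ 'd" by simp
  show ?thesis
  proof (rule conjI; (rule exI[of _ \<gamma>], rule conjI[OF \<gamma>(1)])+)
    show "\<exists>C. \<forall>f g h. test_function f \<longrightarrow> test_function g \<longrightarrow> norm h < 1 \<longrightarrow>
            L2_norm (maximal_op m E (\<lambda>x. f x - translate h f x) g)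
            + L2_norm (maximal_op m E f (\<lambda>x. g x - translate h g x))
            \<le> ennreal (C * norm h powr \<gamma>)
                * L2_norm (\<lambda>x. ennreal (norm (f x))) * L2_norm (\<lambda>x. ennreal (norm (g x)))"
    \<comment> \<open>The 2 adds up two terms with the same bound.\<close>
    proof (intro exI[of _ "2 * (C * c)"] allI impI)
      fix f g :: "real ^ 'd \<Rightarrow> complex" and h :: "real ^ 'd"
      assume f: "test_function f" and g: "test_function g"
      let ?N = "L2_norm (\<lambda>x. ennreal (norm (f x))) * L2_norm (\<lambda>x. ennreal (norm (g x)))"
      have "L2_norm (maximal_op m E (\<lambda>x. f x - translate h f x) g) \<le> ennreal (C * (c * norm h powr \<gamma>)) * ?N"
      proof -
        have "L2_norm (\<lambda>x. SUP t\<in>E. ennreal (norm (bilin (fourier f) (fourier g) (\<lambda>z. e h (fst z) * 1 * m (t *\<^sub>R z)) x)))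
          \<le> ennreal (C * (c * norm h powr \<gamma>)) * L2_norm (\<lambda>x. ennreal (norm (f x))) * L2_norm (\<lambda>x. ennreal (norm (g x)))"
        proof (rule bound[rule_format, OF f g])
          show "norm (e h (fst z) * 1) \<le> c * norm h powr \<gamma> * rho z powr (2 * \<gamma>)" for z
            using order_trans[OF e_bound(1) up] by simp
        qed (use c0 e_meas in simp_all)
        then show ?thesis
          by (simp only: maximal_op_eq_bilin[OF fe[OF f] id] mult.assoc)
      qed
      moreover have "L2_norm (maximal_op m E f (\<lambda>x. g x - translate h g x)) \<le> ennreal (C * (c * norm h powr \<gamma>)) * ?N"
      proof -
        have "L2_norm (\<lambda>x. SUP t\<in>E. ennreal (norm (bilin (fourier f) (fourier g) (\<lambda>z. 1 * e h (snd z) * m (t *\<^sub>R z)) x)))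
          \<le> ennreal (C * (c * norm h powr \<gamma>)) * L2_norm (\<lambda>x. ennreal (norm (f x))) * L2_norm (\<lambda>x. ennreal (norm (g x)))"
        proof (rule bound[rule_format, OF f g])
          show "norm (1 * e h (snd z)) \<le> c * norm h powr \<gamma> * rho z powr (2 * \<gamma>)" for z
            using order_trans[OF e_bound(2) up] by simp
        qed (use c0 e_meas in simp_all)
        then show ?thesis
          by (simp only: maximal_op_eq_bilin[OF id fe[OF g]] mult.assoc)
      qed
      ultimately have "L2_norm (maximal_op m E (\<lambda>x. f x - translate h f x) g) + L2_norm (maximal_op m E f (\<lambda>x. g x - translate h g x))
        \<le> ennreal (C * (c * norm h powr \<gamma>)) * ?N + ennreal (C * (c * norm h powr \<gamma>)) * ?N"
        by (rule add_mono)
      also have "\<dots> = ennreal (2 * (C * c) * norm h powr \<gamma>) * ?N"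
        unfolding distrib_right[symmetric] using C c0 by (subst ennreal_plus[symmetric]) (auto simp: mult.assoc)
      finally show "L2_norm (maximal_op m E (\<lambda>x. f x - translate h f x) g) + L2_norm (maximal_op m E f (\<lambda>x. g x - translate h g x))
        \<le> ennreal (2 * (C * c) * norm h powr \<gamma>) * L2_norm (\<lambda>x. ennreal (norm (f x))) * L2_norm (\<lambda>x. ennreal (norm (g x)))"
        by (simp only: mult.assoc)
    qed
    show "\<exists>C. \<forall>f g h1 h2. test_function f \<longrightarrow> test_function g \<longrightarrow>
            norm h1 < 1 \<longrightarrow> norm h2 < 1 \<longrightarrow>
            L2_norm (maximal_op m E (\<lambda>x. f x - translate h1 f x) (\<lambda>x. g x - translate h2 g x))
            \<le> ennreal (C * norm h1 powr \<gamma> * norm h2 powr \<gamma>)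
                * L2_norm (\<lambda>x. ennreal (norm (f x))) * L2_norm (\<lambda>x. ennreal (norm (g x)))"
    proof (intro exI[of _ "C * (c * c)"] allI impI)
      fix f g :: "real ^ 'd \<Rightarrow> complex" and h1 h2 :: "real ^ 'd"
      assume f: "test_function f" and g: "test_function g"
      \<comment> \<open>Each difference contributes one \<open>rho z powr \<gamma>\<close>, which
        explains the exponent \<open>2 * \<gamma>\<close> in the general bound and lets both
        exponents of the claim be \<open>\<gamma>\<close>.\<close>
      have b: "norm (e h1 (fst z) * e h2 (snd z)) \<le> (c * c * norm h1 powr \<gamma> * norm h2 powr \<gamma>) * rho z powr (2 * \<gamma>)" for z
      proof -
        have "norm (e h1 (fst z) * e h2 (snd z)) \<le> (c * norm h1 powr \<gamma> * rho z powr \<gamma>) * (c * norm h2 powr \<gamma> * rho z powr \<gamma>)"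
          unfolding norm_mult by (intro mult_mono e_bound) (use c0 in auto)
        also have "\<dots> = (c * c * norm h1 powr \<gamma> * norm h2 powr \<gamma>) * (rho z powr \<gamma> * rho z powr \<gamma>)"
          by (simp only: mult_ac)
        also have "rho z powr \<gamma> * rho z powr \<gamma> = rho z powr (2 * \<gamma>)"
          by (simp add: powr_add[symmetric])
        finally show ?thesis .
      qed
      have "L2_norm (maximal_op m E (\<lambda>x. f x - translate h1 f x) (\<lambda>x. g x - translate h2 g x))
        \<le> ennreal (C * (c * c * norm h1 powr \<gamma> * norm h2 powr \<gamma>)) * L2_norm (\<lambda>x. ennreal (norm (f x))) * L2_norm (\<lambda>x. ennreal (norm (g x)))"
        unfolding maximal_op_eq_bilin[OF fe[OF f] fe[OF g]]
        by (rule bound[rule_format, OF f g]) (use c0 b e_meas in \<open>auto intro!: borel_measurable_times\<close>)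
      then show "L2_norm (maximal_op m E (\<lambda>x. f x - translate h1 f x) (\<lambda>x. g x - translate h2 g x))
        \<le> ennreal (C * (c * c) * norm h1 powr \<gamma> * norm h2 powr \<gamma>) * L2_norm (\<lambda>x. ennreal (norm (f x))) * L2_norm (\<lambda>x. ennreal (norm (g x)))"
        by (simp only: mult.assoc)
    qed
  qed
qed

end
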